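(* For integers $k,m\ge 2$, $$P_{x_{k,m},w_{k,m}}=1+q+\cdots+q^{\min(k-1,m-1)}.$$
   Context: $P_{x,w}=P_{x,w}(q)$ denotes the Kazhdan–Lusztig polynomial indexed by $x,w$ in the symmetric group $\mathfrak{S}_n$ (normalized as usual: $P_{x,w}=0$ unless $x\le w$ in Bruhat order, $P_{w,w}=1$, and $\deg P_{x,w}\le\frac12(l(w)-l(x)-1)$ for $x<w$). In $\mathfrak{S}_{k+m}$, in one-line notation, $$x_{k,m}=[k,\ldots,1,k+m,\ldots,k+1],\qquad w_{k,m}=[k+m,k,\ldots,2,k+m-1,\ldots,k+1,1],$$ where each range "$a,\ldots,b$" denotes the decreasing run of consecutive integers from $a$ down to $b$. *)

theory Defs
  imports
    "HOL-Algebra.Ring"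
    "HOL-Algebra.Sym_Groups"
    "HOL-Library.Poly_Mapping"
    "HOL-Computational_Algebra.Polynomial"
begin

section \<open>The symmetric group as a Coxeter group\<close>

text \<open>Permutations are elements of \<^term>\<open>sym_group n\<close>, i.e. functions permuting
  \<open>{1..n}\<close> (and fixing everything else), multiplied by composition.\<close>

type_synonym perm = "nat \<Rightarrow> nat"

definition adj_transp :: "nat \<Rightarrow> perm" where
  "adj_transp i = transpose i (Suc i)"

definition perm_length :: "nat \<Rightarrow> perm \<Rightarrow> nat" where
  "perm_length n w = card {(i, j). i \<in> {1..n} \<and> j \<in> {1..n} \<and> i < j \<and> w j < w i}"

definition bruhat_step :: "nat \<Rightarrow> perm \<Rightarrow> perm \<Rightarrow> bool" where
  "bruhat_step n x y \<longleftrightarrow>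
     (\<exists>i \<in> {1..n}. \<exists>j \<in> {1..n}. i < j \<and> y = x \<circ> transpose i j \<and> perm_length n x < perm_length n y)"

definition bruhat_le :: "nat \<Rightarrow> perm \<Rightarrow> perm \<Rightarrow> bool" where
  "bruhat_le n x y \<longleftrightarrow>
     x \<in> carrier (sym_group n) \<and> y \<in> carrier (sym_group n) \<and> (bruhat_step n)\<^sup>*\<^sup>* x y"

definition is_reduced_word :: "nat \<Rightarrow> nat list \<Rightarrow> perm \<Rightarrow> bool" where
  "is_reduced_word n ss w \<longleftrightarrow>
     set ss \<subseteq> {1..<n} \<and> foldr (\<lambda>i u. adj_transp i \<circ> u) ss id = w \<and> length ss = perm_length n w"

section \<open>Laurent polynomials in the square root of q\<close>

text \<open>A Laurent polynomial over the integers is an element of the group algebra of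
  \<open>(\<int>, +)\<close>; the basis element of degree \<open>k\<close> is the power \<open>q\<^bsup>k/2\<^esup>\<close>.\<close>

type_synonym laurent = "int \<Rightarrow>\<^sub>0 int"

definition qhalf_power :: "int \<Rightarrow> laurent" where
  "qhalf_power k = Poly_Mapping.single k 1"

definition hecke_q :: laurent where
  "hecke_q = qhalf_power 2"

definition laurent_bar :: "laurent \<Rightarrow> laurent" where
  "laurent_bar f = Poly_Mapping.map_key uminus f"

definition poly_in_q :: "int poly \<Rightarrow> laurent" where
  "poly_in_q p = poly (map_poly of_int p) hecke_q"

section \<open>The Iwahori--Hecke algebra of the symmetric group\<close>

text \<open>An element is given by its coefficients in the standard basis \<open>T\<^sub>w\<close>.\<close>

type_synonym hecke_elem = "perm \<Rightarrow> laurent"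

definition T_basis :: "perm \<Rightarrow> hecke_elem" where
  "T_basis w = (\<lambda>x. if x = w then 1 else 0)"

text \<open>The product of the generator of index \<open>i\<close> with a basis element, as prescribed by
  \<open>T\<^sub>s T\<^sub>w = T\<^sub>s\<^sub>w\<close> if \<open>l(sw) > l(w)\<close>, and \<open>T\<^sub>s T\<^sub>w = q T\<^sub>s\<^sub>w + (q - 1) T\<^sub>w\<close> otherwise.\<close>

definition gen_times_T :: "nat \<Rightarrow> nat \<Rightarrow> perm \<Rightarrow> hecke_elem" where
  "gen_times_T n i w =
     (if perm_length n w < perm_length n (adj_transp i \<circ> w)
      then T_basis (adj_transp i \<circ> w)
      else (\<lambda>x. hecke_q * T_basis (adj_transp i \<circ> w) x + (hecke_q - 1) * T_basis w x))"

definition gen_times :: "nat \<Rightarrow> nat \<Rightarrow> hecke_elem \<Rightarrow> hecke_elem" where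
  "gen_times n i h = (\<lambda>x. \<Sum>w \<in> carrier (sym_group n). h w * gen_times_T n i w x)"

text \<open>\<open>T\<^sub>u\<close> is the product of the generators along any reduced word of \<open>u\<close>; by the braid
  relations the choice of the word does not matter.\<close>

definition T_times :: "nat \<Rightarrow> perm \<Rightarrow> hecke_elem \<Rightarrow> hecke_elem" where
  "T_times n u h = foldr (gen_times n) (SOME ss. is_reduced_word n ss u) h"

definition hecke_mult :: "nat \<Rightarrow> hecke_elem \<Rightarrow> hecke_elem \<Rightarrow> hecke_elem" where
  "hecke_mult n g h = (\<lambda>x. \<Sum>u \<in> carrier (sym_group n). g u * T_times n u h x)"

definition hecke :: "nat \<Rightarrow> hecke_elem ring" where
  "hecke n =
     \<lparr> carrier = {h. \<forall>w. w \<notin> carrier (sym_group n) \<longrightarrow> h w = 0},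
       monoid.mult = hecke_mult n,
       one = T_basis id,
       zero = (\<lambda>_. 0),
       add = (\<lambda>g h x. g x + h x) \<rparr>"

text \<open>The bar involution: semilinear over \<open>q\<^bsup>1/2\<^esup> \<mapsto> q\<^bsup>-1/2\<^esup>\<close>, taking \<open>T\<^sub>w\<close> to the inverse
  of the basis element indexed by the inverse of \<open>w\<close>.\<close>

definition hecke_bar :: "nat \<Rightarrow> hecke_elem \<Rightarrow> hecke_elem" where
  "hecke_bar n h = (\<lambda>x. \<Sum>w \<in> carrier (sym_group n).
     laurent_bar (h w) * (inv\<^bsub>hecke n\<^esub> (T_basis (inv\<^bsub>sym_group n\<^esub> w))) x)"

section \<open>Kazhdan--Lusztig polynomials\<close>

text \<open>The element \<open>C'\<^sub>w = q\<^bsup>-l(w)/2\<^esup> \<Sum>\<^sub>x P\<^sub>x\<^sub>,\<^sub>w(q) T\<^sub>x\<close> attached to a candidate family \<open>P\<close>.\<close>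

definition KL_elem :: "nat \<Rightarrow> perm \<Rightarrow> (perm \<Rightarrow> int poly) \<Rightarrow> hecke_elem" where
  "KL_elem n w P = (\<lambda>x. qhalf_power (- int (perm_length n w)) * poly_in_q (P x))"

text \<open>The degree condition is \<open>deg P\<^sub>x\<^sub>,\<^sub>w \<le> (l(w) - l(x) - 1) / 2\<close> without division or
  truncated subtraction; it holds for a zero polynomial, since \<open>x < w\<close> forces \<open>l(x) < l(w)\<close>.\<close>

definition is_KL_family :: "nat \<Rightarrow> perm \<Rightarrow> (perm \<Rightarrow> int poly) \<Rightarrow> bool" where
  "is_KL_family n w P \<longleftrightarrow>
     (\<forall>x. \<not> bruhat_le n x w \<longrightarrow> P x = 0) \<and>
     P w = 1 \<and>
     (\<forall>x. bruhat_le n x w \<and> x \<noteq> w \<longrightarrow> 2 * degree (P x) + perm_length n x + 1 \<le> perm_length n w) \<and>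
     hecke_bar n (KL_elem n w P) = KL_elem n w P"

definition KL_poly :: "nat \<Rightarrow> perm \<Rightarrow> perm \<Rightarrow> int poly" where
  "KL_poly n x w = (THE P. is_KL_family n w P) x"

section \<open>One-line notation\<close>

definition one_line :: "nat list \<Rightarrow> perm" where
  "one_line xs i = (if 1 \<le> i \<and> i \<le> length xs then xs ! (i - 1) else i)"

text \<open>The decreasing run \<open>a, a - 1, \<dots>, b\<close>.\<close>

definition run_down :: "nat \<Rightarrow> nat \<Rightarrow> nat list" where
  "run_down a b = rev [b..<Suc a]"

definition x_perm :: "nat \<Rightarrow> nat \<Rightarrow> perm" where
  "x_perm k m = one_line (run_down k 1 @ run_down (k + m) (k + 1))"

definition w_perm :: "nat \<Rightarrow> nat \<Rightarrow> perm" where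
  "w_perm k m = one_line ([k + m] @ run_down k 2 @ run_down (k + m - 1) (k + 1) @ [1])"

end

theory Submission
  imports Defs
begin

text \<open>
  Let \<open>n = k + m\<close> and let \<open>W\<^sub>J\<close> be the subgroup of permutations preserving \<open>{1..k}\<close>. The permutation \<open>x\<close> is
  the longest element of \<open>W\<^sub>J\<close>, and \<open>w\<close> is the longest element of the double coset \<open>D\<close> of those
  permutations that send exactly one element of \<open>{1..k}\<close> outside. In the Grassmannian of
  \<open>k\<close>-dimensional subspaces, \<open>w\<close> describes the Schubert variety of subspaces that meet a fixed subspace
  \<open>V\<^sub>0\<close> in codimension at most one; at its only singular point \<open>V\<^sub>0\<close> it looks locally like a cone over the product of
  two projective spaces of dimensions \<open>k - 1\<close> and \<open>m - 1\<close>. It has two natural resolutions, with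
  these projective spaces as fibres over \<open>V\<^sub>0\<close>; the one with the smaller fibre is small, and the
  Poincare polynomial of that fibre is the polynomial sought. So the
  whole Kazhdan--Lusztig element is
  \<open>C'\<^sub>w = q\<^bsup>-l(w)/2\<^esup> (\<Sum>\<^bsub>y \<in> D\<^esub> T\<^sub>y + [min k m] \<Sum>\<^bsub>y \<in> W_J\<^esub> T\<^sub>y)\<close>, where \<open>[j] = 1 + q + \<dots> + q\<^sup>j\<^sup>-\<^sup>1\<close>,
  and the proof verifies the characterisation of this element.

  Uniqueness is the classical argument: the bar involution is unitriangular for the length up to powers
  of \<open>q\<close> (\<open>bar_T_triangular\<close>), so an invariant element whose coefficients have strictly small degree
  vanishes (\<open>bar_invariant_eq_zero\<close>). To know the bar involution, one has to know the inverses
  of the basis elements. Left multiplications by generators commute with right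
  multiplications, which makes \<open>T\<^sub>u\<close> independent of the reduced word and yields the inverses
  (\<open>reduced_word_independent\<close>, \<open>inverse_T_basis\<close>). The upshot is one rule: the bar involution
  turns left multiplication by \<open>T\<^sub>s\<close> into left multiplication by its inverse
  (\<open>hecke_bar_gen_times\<close>), hence commutes with \<open>q\<^sup>-\<^sup>1\<^sup>/\<^sup>2 (T\<^sub>s + 1)\<close>.

  Invariance of the displayed element follows by building it from the sum over \<open>W\<^sub>J\<close>, whose
  invariance holds because it is an eigenvector of all \<open>T\<^sub>s\<close> with \<open>s \<in> W\<^sub>J\<close> (\<open>self_dual_parabolic\<close>). All the
  elements involved are constant on left cosets of \<open>W\<^sub>J\<close>, that is, they are combinations of cells indexed by
  \<open>k\<close>-subsets. Applying \<open>T\<^sub>s + 1\<close> enlarges a Schubert variety by one column or one row and counts the part that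
  did not move \<open>1 + q\<close> times; subtracting \<open>q\<close> times the variety two steps before repairs this
  (\<open>column_sum_step\<close>, \<open>rows_sum_step\<close>). The result has the factor \<open>[k]\<close> on \<open>W\<^sub>J\<close>, which for \<open>k > m\<close> is reduced
  to \<open>[m]\<close> by subtracting a palindromic multiple of the sum over \<open>W\<^sub>J\<close> (\<open>self_dual_schubert_sum\<close>).
  Finally every element of \<open>W\<^sub>J\<close> and \<open>D\<close> lies below \<open>w\<close> in the Bruhat order, because ascents within these two
  double cosets lead to \<open>w\<close> (\<open>at_most_one_exchange_ascend\<close>), and \<open>l(w) - l(x) = k + m - 1\<close> makes the
  degree bound hold.
\<close>

(* Intervals {1..n} stay in this form and do not become {Suc 0..n}. *)
declare One_nat_def [simp del]

section \<open>Laurent polynomials\<close>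

lemma lookup_laurent_bar: "Poly_Mapping.lookup (laurent_bar f) k = Poly_Mapping.lookup f (- k)"
  unfolding laurent_bar_def by (simp add: map_key.rep_eq)

lemma laurent_bar_add: "laurent_bar (f + g) = laurent_bar f + laurent_bar g"
  by (rule poly_mapping_eqI) (simp add: lookup_laurent_bar lookup_add)

lemma laurent_bar_diff: "laurent_bar (f - g) = laurent_bar f - laurent_bar g"
  by (rule poly_mapping_eqI) (simp add: lookup_laurent_bar lookup_minus)

lemma laurent_bar_zero [simp]: "laurent_bar 0 = 0"
  by (rule poly_mapping_eqI) (simp add: lookup_laurent_bar)

lemma laurent_bar_single: "laurent_bar (Poly_Mapping.single k c) = Poly_Mapping.single (- k) c"
  by (rule poly_mapping_eqI) (auto simp: lookup_laurent_bar lookup_single when_def)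

lemma laurent_bar_qhalf_power: "laurent_bar (qhalf_power k) = qhalf_power (- k)"
  by (simp add: qhalf_power_def laurent_bar_single)

lemma qhalf_power_mult: "qhalf_power a * qhalf_power b = qhalf_power (a + b)"
  by (simp add: qhalf_power_def mult_single)

lemma qhalf_power_zero: "qhalf_power 0 = 1"
  by (simp add: qhalf_power_def)

lemma laurent_bar_one [simp]: "laurent_bar 1 = 1"
  using laurent_bar_qhalf_power[of 0] by (simp add: qhalf_power_zero)

text \<open>The bar map substitutes \<open>q\<^sup>-\<^sup>1\<close> for \<open>q\<close>; by bilinearity it is enough to compare products of
  two powers of \<open>q\<^sup>1\<^sup>/\<^sup>2\<close>.\<close>

lemma laurent_bar_mult: "laurent_bar (f * g) = laurent_bar f * laurent_bar g"
proof (induction f rule: frag_induction[OF subset_UNIV])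
  case 1
  show ?case by simp
next
  case (2 a)
  show ?case
  proof (induction g rule: frag_induction[OF subset_UNIV])
    case 1
    show ?case by simp
  next
    case (2 b)
    show ?case by (simp add: laurent_bar_single mult_single)
  next
    case (3 f g)
    then show ?case by (simp add: laurent_bar_diff right_diff_distrib)
  qed
next
  case (3 f g)
  then show ?case by (simp add: laurent_bar_diff left_diff_distrib)
qed

lemma q_times_inverse: "hecke_q * qhalf_power (-2) = 1" "qhalf_power (-2) * hecke_q = 1"
  by (simp_all add: hecke_q_def qhalf_power_mult qhalf_power_zero)

lemma hecke_q_power: "hecke_q ^ i = qhalf_power (2 * int i)"
  by (induction i) (auto simp: hecke_q_def qhalf_power_mult qhalf_power_zero algebra_simps)

text \<open>Only even degrees in \<open>q\<^sup>1\<^sup>/\<^sup>2\<close> occur. This makes \<^const>\<open>poly_in_q\<close> injective and turns the degree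
  condition on Kazhdan--Lusztig polynomials into a bound on the support of a Laurent polynomial.\<close>

lemma lookup_poly_in_q:
  "Poly_Mapping.lookup (poly_in_q p) j = (\<Sum>i\<le>degree p. if j = 2 * int i then coeff p i else 0)"
proof -
  have le: "degree (map_poly of_int p :: laurent poly) \<le> degree p"
    by (rule degree_le) (simp add: coeff_map_poly coeff_eq_0)
  have "poly_in_q p = (\<Sum>i\<le>degree p. coeff (map_poly of_int p) i * hecke_q ^ i)"
    unfolding poly_in_q_def poly_altdef
    by (rule sum.mono_neutral_left) (use le in \<open>auto simp: coeff_eq_0\<close>)
  also have "\<dots> = (\<Sum>i\<le>degree p. Poly_Mapping.single (2 * int i) (coeff p i))"
  proof (rule sum.cong)
    fix i
    have "coeff (map_poly of_int p :: laurent poly) i = Poly_Mapping.single 0 (coeff p i)"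
      by (simp add: coeff_map_poly poly_mapping_eq_iff fun_eq_iff lookup_of_int lookup_single)
    then show "coeff (map_poly of_int p) i * hecke_q ^ i = Poly_Mapping.single (2 * int i) (coeff p i)"
      by (simp add: hecke_q_power qhalf_power_def mult_single del: single_of_int)
  qed simp
  finally show ?thesis
    by (simp add: lookup_sum lookup_single when_def) (rule sum.cong, auto)
qed

lemma lookup_poly_in_q_even: "Poly_Mapping.lookup (poly_in_q p) (2 * int i) = coeff p i"
  by (auto simp: lookup_poly_in_q coeff_eq_0)

lemma poly_in_q_inject: "poly_in_q p = poly_in_q r \<longleftrightarrow> p = r"
  by (metis lookup_poly_in_q_even poly_eq_iff)

lemma lookup_poly_in_q_high:
  assumes "2 * int (degree p) < j"
  shows "Poly_Mapping.lookup (poly_in_q p) j = 0"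
  unfolding lookup_poly_in_q using assms by (intro sum.neutral) auto

lemma poly_in_q_zero [simp]: "poly_in_q 0 = 0"
  by (simp add: poly_in_q_def)

lemma poly_in_q_one [simp]: "poly_in_q 1 = 1"
  by (simp add: poly_in_q_def)

lemma poly_in_q_add: "poly_in_q (p + r) = poly_in_q p + poly_in_q r"
proof -
  have "map_poly of_int (p + r) = (map_poly of_int p + map_poly of_int r :: laurent poly)"
    by (rule poly_eqI) (simp add: coeff_map_poly)
  then show ?thesis by (simp add: poly_in_q_def)
qed

lemma poly_in_q_monom: "poly_in_q (monom 1 i) = hecke_q ^ i"
  by (simp add: poly_in_q_def map_poly_monom poly_monom)

text \<open>The quantum integer \<open>[j] = 1 + q + \<dots> + q\<^sup>j\<^sup>-\<^sup>1\<close>, the Poincare polynomial of a projective space.\<close>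

definition q_int :: "nat \<Rightarrow> laurent" where
  "q_int j = (\<Sum>i<j. hecke_q ^ i)"

lemma q_int_zero [simp]: "q_int 0 = 0"
  and q_int_Suc: "q_int (Suc j) = q_int j + hecke_q ^ j"
  by (auto simp: q_int_def)

lemma poly_in_q_geometric: "poly_in_q (\<Sum>i<j. monom 1 i) = q_int j"
  by (induction j) (auto simp: q_int_Suc poly_in_q_add poly_in_q_monom)

lemma q_int_add: "q_int (i + j) = q_int i + hecke_q ^ i * q_int j"
  by (induction j) (auto simp: q_int_Suc algebra_simps power_add)

text \<open>This recurrence produces the value at the identity coset when the Schubert variety is
  enlarged by one row, see \<open>rows_sum_step\<close> below.\<close>

lemma q_int_recurrence: "(1 + hecke_q) * q_int (Suc j) = q_int (Suc (Suc j)) + hecke_q * q_int j"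
  by (induction j) (auto simp: q_int_Suc algebra_simps)

text \<open>The coefficients of \<open>[j + 1]\<close> are palindromic about \<open>q\<^sup>j\<^sup>/\<^sup>2\<close>.\<close>

lemma laurent_bar_q_int: "laurent_bar (q_int (Suc j)) = qhalf_power (- 2 * int j) * q_int (Suc j)"
proof (induction j)
  case 0
  show ?case by (simp add: q_int_Suc qhalf_power_zero)
next
  case (Suc j)
  have bar_q: "laurent_bar (hecke_q ^ i) = qhalf_power (- 2 * int i)" for i
    by (simp add: hecke_q_power laurent_bar_qhalf_power)
  have *: "q_int (Suc (Suc j)) = 1 + hecke_q * q_int (Suc j)"
    using q_int_add[of "Suc 0" "Suc j"] by (simp add: q_int_Suc)
  have "laurent_bar (q_int (Suc (Suc j))) = laurent_bar (q_int (Suc j)) + laurent_bar (hecke_q ^ Suc j)"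
    by (subst q_int_Suc) (rule laurent_bar_add)
  also have "\<dots> = qhalf_power (- 2 * int j) * q_int (Suc j) + qhalf_power (- 2 * int (Suc j))"
    by (simp only: Suc.IH bar_q)
  also have "qhalf_power (- 2 * int j) = qhalf_power (- 2 * int (Suc j)) * hecke_q"
    by (simp add: hecke_q_def qhalf_power_mult)
  finally show ?case
    by (subst (2) *) (simp only: algebra_simps mult_1_right mult_1_left)
qed

section \<open>Lengths of permutations\<close>

definition inversions :: "nat \<Rightarrow> perm \<Rightarrow> (nat \<times> nat) set" where
  "inversions n w = {(i, j). i \<in> {1..n} \<and> j \<in> {1..n} \<and> i < j \<and> w j < w i}"

lemma perm_length_inversions: "perm_length n w = card (inversions n w)"
  by (simp add: perm_length_def inversions_def)

lemma finite_inversions [simp]: "finite (inversions n w)"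
  by (rule finite_subset[of _ "{1..n} \<times> {1..n}"]) (auto simp: inversions_def)

lemma finite_perms [simp]: "finite {w. w permutes {1..n::nat}}"
  by (rule finite_permutations) simp

lemma perm_range:
  assumes "w permutes {1..n}"
  shows "w i \<in> {1..n} \<longleftrightarrow> i \<in> {1..n}"
  using assms by (rule permutes_in_image)

lemma inv_perm_eq_iff:
  assumes "x permutes S"
  shows "Hilbert_Choice.inv x i = j \<longleftrightarrow> i = x j"
  by (metis assms permutes_inverses)

lemma adj_transp_permutes:
  assumes "i \<in> {1..<n}"
  shows "adj_transp i permutes {1..n}"
  unfolding adj_transp_def using assms by (intro permutes_swap_id) auto

lemma adj_transp_twice [simp]:
  "adj_transp i (adj_transp i a) = a" "adj_transp i \<circ> (adj_transp i \<circ> x) = x"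
  "adj_transp i \<circ> adj_transp i = id" "x \<circ> adj_transp i \<circ> adj_transp i = x"
  by (auto simp: adj_transp_def fun_eq_iff)

lemma adj_transp_simps [simp]:
  "adj_transp i i = Suc i" "adj_transp i (Suc i) = i"
  by (auto simp: adj_transp_def)

lemma adj_transp_other: "a \<noteq> i \<Longrightarrow> a \<noteq> Suc i \<Longrightarrow> adj_transp i a = a"
  by (auto simp: adj_transp_def)

lemma adj_transp_less_iff:
  "adj_transp i u < adj_transp i v \<longleftrightarrow> (u < v \<and> \<not> (u = i \<and> v = Suc i)) \<or> (u = Suc i \<and> v = i)"
  by (auto simp: adj_transp_def transpose_def)

lemma left_mult_permutes:
  assumes "i \<in> {1..<n}"
  shows "adj_transp i \<circ> x permutes {1..n} \<longleftrightarrow> x permutes {1..n}"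
  using permutes_compose[OF _ adj_transp_permutes[OF assms]]
  by (metis adj_transp_twice(2))

lemma right_mult_permutes:
  assumes "i \<in> {1..<n}"
  shows "x \<circ> adj_transp i permutes {1..n} \<longleftrightarrow> x permutes {1..n}"
  using permutes_compose[OF adj_transp_permutes[OF assms]]
  by (metis adj_transp_twice(4))

lemma inv_left_mult:
  assumes "x permutes {1..n}"
  shows "Hilbert_Choice.inv (adj_transp i \<circ> x) = Hilbert_Choice.inv x \<circ> adj_transp i"
  using assms by (simp add: o_inv_distrib permutes_bij adj_transp_def)

lemma inv_right_mult:
  assumes "x permutes {1..n}"
  shows "Hilbert_Choice.inv (x \<circ> adj_transp i) = adj_transp i \<circ> Hilbert_Choice.inv x"
  using assms by (simp add: o_inv_distrib permutes_bij adj_transp_def)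

text \<open>The value \<open>i\<close> stands to the left of \<open>i + 1\<close> in one-line notation. Together with
  \<open>perm_length_left_less_iff\<close> this replaces comparisons of lengths by comparisons of two positions.\<close>

abbreviation left_ascent :: "nat \<Rightarrow> perm \<Rightarrow> bool" where
  "left_ascent i x \<equiv> Hilbert_Choice.inv x i < Hilbert_Choice.inv x (Suc i)"

lemma inv_neq_Suc:
  assumes "x permutes S"
  shows "Hilbert_Choice.inv x i \<noteq> Hilbert_Choice.inv x (Suc i)"
  by (metis assms n_not_Suc_n permutes_inverses(1))

lemma left_ascent_left_mult:
  assumes "x permutes {1..n}"
  shows "left_ascent i (adj_transp i \<circ> x) \<longleftrightarrow> \<not> left_ascent i x"
  using inv_neq_Suc[OF assms, of i] by (auto simp: inv_left_mult[OF assms])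

text \<open>Exchanging the values \<open>i\<close> and \<open>i + 1\<close> affects the order of no other pair of values, so exactly the
  pair of their positions becomes a new inversion.\<close>

lemma perm_length_left_ascent:
  assumes x: "x permutes {1..n}" and i: "i \<in> {1..<n}" and asc: "left_ascent i x"
  shows "perm_length n (adj_transp i \<circ> x) = Suc (perm_length n x)"
proof -
  let ?p = "Hilbert_Choice.inv x i" and ?q = "Hilbert_Choice.inv x (Suc i)"
  have xp: "x ?p = i" "x ?q = Suc i"
    using x by (simp_all add: permutes_inverses)
  have pq: "?p \<in> {1..n}" "?q \<in> {1..n}"
    using i perm_range[OF permutes_inv[OF x]] by simp_all
  have inj: "x a = x b \<longleftrightarrow> a = b" for a b
    using permutes_inj[OF x] by (simp add: inj_eq)
  have eq: "inversions n (adj_transp i \<circ> x) = insert (?p, ?q) (inversions n x)"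
  proof (rule Set.set_eqI)
    fix z :: "nat \<times> nat"
    have "x a = Suc i \<longleftrightarrow> a = ?q" "x a = i \<longleftrightarrow> a = ?p" for a
      using inj xp by metis+
    then show "z \<in> inversions n (adj_transp i \<circ> x) \<longleftrightarrow> z \<in> insert (?p, ?q) (inversions n x)"
      using pq asc by (cases z) (auto simp: inversions_def adj_transp_less_iff)
  qed
  have "(?p, ?q) \<notin> inversions n x"
    by (auto simp: inversions_def xp)
  then show ?thesis
    by (simp add: perm_length_inversions eq)
qed

lemma perm_length_left_descent:
  assumes x: "x permutes {1..n}" and i: "i \<in> {1..<n}" and desc: "\<not> left_ascent i x"
  shows "perm_length n x = Suc (perm_length n (adj_transp i \<circ> x))"
  using perm_length_left_ascent[of "adj_transp i \<circ> x" n i] assms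
  by (simp add: left_mult_permutes[OF i] left_ascent_left_mult[OF x])

lemma perm_length_left_less_iff:
  assumes x: "x permutes {1..n}" and i: "i \<in> {1..<n}"
  shows "perm_length n x < perm_length n (adj_transp i \<circ> x) \<longleftrightarrow> left_ascent i x"
  using perm_length_left_ascent[OF assms] perm_length_left_descent[OF assms] by fastforce

text \<open>Swapping positions with values carries the inversions of \<open>x\<close> to those of its inverse. This
  transfers statements on left multiplication to right multiplication.\<close>

lemma perm_length_inv:
  assumes x: "x permutes {1..n}"
  shows "perm_length n (Hilbert_Choice.inv x) = perm_length n x"
proof -
  let ?y = "Hilbert_Choice.inv x"
  have y: "?y permutes {1..n}" and xy: "x (?y a) = a" "?y (x a) = a" for a
    using x by (simp_all add: permutes_inv permutes_inverses)
  have range: "1 \<le> a \<Longrightarrow> a \<le> n \<Longrightarrow> 1 \<le> x a \<and> x a \<le> n \<and> 1 \<le> ?y a \<and> ?y a \<le> n" for a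
    using perm_range[OF x, of a] perm_range[OF y, of a] by simp
  have "bij_betw (\<lambda>(a, b). (x b, x a)) (inversions n x) (inversions n ?y)"
    by (rule bij_betw_byWitness[where f' = "\<lambda>(a, b). (?y b, ?y a)"])
       (auto simp: inversions_def xy range)
  then show ?thesis
    by (simp add: perm_length_inversions bij_betw_same_card)
qed

lemma perm_length_right_ascent:
  assumes x: "x permutes {1..n}" and i: "i \<in> {1..<n}" and asc: "x i < x (Suc i)"
  shows "perm_length n (x \<circ> adj_transp i) = Suc (perm_length n x)"
proof -
  let ?y = "Hilbert_Choice.inv x"
  have y: "?y permutes {1..n}" and invy: "Hilbert_Choice.inv ?y = x"
    using x by (simp_all add: permutes_inv permutes_inv_inv)
  have "perm_length n (adj_transp i \<circ> ?y) = Suc (perm_length n ?y)"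
    using perm_length_left_ascent[OF y i] asc by (simp add: invy)
  moreover have "perm_length n (adj_transp i \<circ> ?y) = perm_length n (x \<circ> adj_transp i)"
    using perm_length_inv[of "x \<circ> adj_transp i" n] x
    by (simp add: inv_right_mult[OF x] right_mult_permutes[OF i])
  ultimately show ?thesis
    using perm_length_inv[OF x] by simp
qed

lemma perm_length_right_descent:
  assumes x: "x permutes {1..n}" and i: "i \<in> {1..<n}" and desc: "x (Suc i) < x i"
  shows "perm_length n x = Suc (perm_length n (x \<circ> adj_transp i))"
  using perm_length_right_ascent[of "x \<circ> adj_transp i" n i] assms
  by (simp add: right_mult_permutes[OF i])

lemma perm_length_id [simp]: "perm_length n id = 0"
proof -
  have "inversions n id = {}"
    by (auto simp: inversions_def)
  then show ?thesis by (simp add: perm_length_inversions)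
qed

text \<open>A strictly increasing sequence of integers from \<open>1\<close> to \<open>n\<close> satisfies both \<open>i \<le> x i\<close> (from the left
  end) and \<open>x i \<le> i\<close> (from the right end).\<close>

lemma perm_without_descent_is_id:
  assumes x: "x permutes {1..n}" and asc: "\<And>i. i \<in> {1..<n} \<Longrightarrow> x i < x (Suc i)"
  shows "x = id"
proof -
  have ge: "i \<le> x i" if "1 \<le> i" "i \<le> n" for i
    using that
  proof (induction i rule: dec_induct)
    case base
    then show ?case using perm_range[OF x, of 1] by auto
  next
    case (step i)
    then show ?case using asc[of i] by fastforce
  qed
  have le: "x i \<le> i" if "1 \<le> i" "i \<le> n" for i
    using that(2,1)
  proof (induction i rule: inc_induct)
    case base
    then show ?case using perm_range[OF x, of n] by auto
  next
    case (step i)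
    then show ?case using asc[of i] by fastforce
  qed
  show ?thesis
  proof
    fix i
    show "x i = id i"
      using ge[of i] le[of i] permutes_not_in[OF x, of i] by (cases "i \<in> {1..n}") auto
  qed
qed

lemma exists_right_descent:
  assumes x: "x permutes {1..n}" and "x \<noteq> id"
  obtains i where "i \<in> {1..<n}" "x (Suc i) < x i"
proof -
  obtain i where "i \<in> {1..<n}" "\<not> x i < x (Suc i)"
    using perm_without_descent_is_id[OF x] assms(2) by blast
  moreover have "x i \<noteq> x (Suc i)"
    using permutes_inj[OF x] by (simp add: inj_eq)
  ultimately show ?thesis using that by force
qed

lemma exists_left_descent:
  assumes x: "x permutes {1..n}" and "x \<noteq> id"
  obtains i where "i \<in> {1..<n}" "\<not> left_ascent i x"
proof -
  have "Hilbert_Choice.inv x \<noteq> id"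
    using assms permutes_inv_inv[OF x] by (metis inv_id)
  then show ?thesis
    using exists_right_descent[OF permutes_inv[OF x]] that by (metis not_less_iff_gr_or_eq)
qed

text \<open>Removing descents one at a time reaches the identity. The step carries the ascent, which
  is what the multiplication rule \<open>T\<^sub>s T\<^sub>w = T\<^sub>s\<^sub>w\<close> requires.\<close>

lemma perm_left_induct [consumes 1, case_names id left_mult]:
  assumes "x permutes {1..n}"
    and "P id"
    and "\<And>i x. \<lbrakk>x permutes {1..n}; i \<in> {1..<n}; left_ascent i x; P x\<rbrakk> \<Longrightarrow> P (adj_transp i \<circ> x)"
  shows "P x"
  using assms(1)
proof (induction "perm_length n x" arbitrary: x rule: less_induct)
  case less
  show ?case
  proof (cases "x = id")
    case False
    then obtain i where i: "i \<in> {1..<n}" "\<not> left_ascent i x"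
      using exists_left_descent less.prems by blast
    let ?y = "adj_transp i \<circ> x"
    have "?y permutes {1..n}" "left_ascent i ?y" "P ?y"
      using i less left_mult_permutes left_ascent_left_mult perm_length_left_descent
      by (metis lessI)+
    from assms(3)[OF this(1) i(1) this(2,3)] show ?thesis by simp
  qed (use assms in simp)
qed

lemma perm_right_induct [consumes 1, case_names id right_mult]:
  assumes "x permutes {1..n}"
    and "P id"
    and "\<And>i x. \<lbrakk>x permutes {1..n}; i \<in> {1..<n}; x i < x (Suc i); P x\<rbrakk> \<Longrightarrow> P (x \<circ> adj_transp i)"
  shows "P x"
  using assms(1)
proof (induction "perm_length n x" arbitrary: x rule: less_induct)
  case less
  show ?case
  proof (cases "x = id")
    case False
    then obtain i where i: "i \<in> {1..<n}" "x (Suc i) < x i"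
      using exists_right_descent less.prems by blast
    let ?y = "x \<circ> adj_transp i"
    have "?y permutes {1..n}" "?y i < ?y (Suc i)" "P ?y"
      using i less right_mult_permutes perm_length_right_descent by (auto)
    from assms(3)[OF this(1) i(1) this(2,3)] show ?thesis by simp
  qed (use assms in simp)
qed

section \<open>Left and right multiplication by generators\<close>

lemma carrier_sym_group: "carrier (sym_group n) = {w. w permutes {1..n}}"
  by (auto simp: sym_group_carrier)

lemma hecke_carrier_iff: "h \<in> carrier (hecke n) \<longleftrightarrow> (\<forall>w. \<not> w permutes {1..n} \<longrightarrow> h w = 0)"
  by (simp add: hecke_def carrier_sym_group)

lemma T_basis_in_carrier: "w permutes {1..n} \<Longrightarrow> T_basis w \<in> carrier (hecke n)"
  by (auto simp: hecke_carrier_iff T_basis_def)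

lemma hecke_elem_expansion:
  assumes "h \<in> carrier (hecke n)"
  shows "(\<lambda>x. \<Sum>w | w permutes {1..n}. h w * T_basis w x) = h"
proof
  fix x
  have "(\<Sum>w | w permutes {1..n}. h w * T_basis w x) =
      (\<Sum>w | w permutes {1..n}. if w = x then h x else 0)"
    by (rule sum.cong) (auto simp: T_basis_def)
  then show "(\<Sum>w | w permutes {1..n}. h w * T_basis w x) = h x"
    using assms by (auto simp: sum.delta hecke_carrier_iff)
qed

text \<open>A closure principle for identities between (semi)linear operators: they need only be
  checked on the standard basis.\<close>

lemma hecke_span_induct [consumes 1, case_names zero add scale basis]:
  assumes "h \<in> carrier (hecke n)"
    and zero: "P (\<lambda>_. 0)"
    and add: "\<And>f g. P f \<Longrightarrow> P g \<Longrightarrow> f \<in> carrier (hecke n) \<Longrightarrow> g \<in> carrier (hecke n) \<Longrightarrow> P (\<lambda>x. f x + g x)"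
    and scale: "\<And>c f. P f \<Longrightarrow> f \<in> carrier (hecke n) \<Longrightarrow> P (\<lambda>x. c * f x)"
    and basis: "\<And>w. w permutes {1..n} \<Longrightarrow> P (T_basis w)"
  shows "P h"
proof -
  have "P (\<lambda>x. \<Sum>w\<in>A. h w * T_basis w x) \<and> (\<lambda>x. \<Sum>w\<in>A. h w * T_basis w x) \<in> carrier (hecke n)"
    if "finite A" "A \<subseteq> {w. w permutes {1..n}}" for A
    using that
  proof (induction A rule: finite_induct)
    case empty
    then show ?case using zero by (simp add: hecke_carrier_iff)
  next
    case (insert w A)
    have "T_basis w \<in> carrier (hecke n)" "P (T_basis w)"
      using insert basis T_basis_in_carrier by auto
    then have "P (\<lambda>x. h w * T_basis w x)" "(\<lambda>x. h w * T_basis w x) \<in> carrier (hecke n)"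
      using scale by (auto simp: hecke_carrier_iff)
    with insert show ?case
      by (auto intro!: add simp: hecke_carrier_iff)
  qed
  from this[of "{w. w permutes {1..n}}"] show ?thesis
    by (simp add: hecke_elem_expansion[OF assms(1)])
qed

lemma gen_times_add: "gen_times n i (\<lambda>x. f x + g x) = (\<lambda>x. gen_times n i f x + gen_times n i g x)"
  by (simp add: gen_times_def distrib_right sum.distrib)

lemma gen_times_scale: "gen_times n i (\<lambda>x. c * f x) = (\<lambda>x. c * gen_times n i f x)"
  by (simp add: gen_times_def sum_distrib_left mult.assoc)

lemma gen_times_zero: "gen_times n i (\<lambda>_. 0) = (\<lambda>_. 0)"
  by (simp add: gen_times_def)

text \<open>Left multiplication by \<open>T\<^sub>s\<close> read coefficientwise: the coefficient at \<open>x\<close> depends only on the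
  coefficients at \<open>x\<close> and \<open>s x\<close>. All later computations use this form.\<close>

lemma gen_times_apply:
  assumes x: "x permutes {1..n}" and i: "i \<in> {1..<n}"
  shows "gen_times n i h x =
    (if left_ascent i x then hecke_q * h (adj_transp i \<circ> x)
     else h (adj_transp i \<circ> x) + (hecke_q - 1) * h x)"
proof -
  let ?s = "\<lambda>x. adj_transp i \<circ> x"
  have T: "T_basis (?s w) x = (if w = ?s x then 1 else 0)" "T_basis w x = (if w = x then 1 else 0)" for w
    using adj_transp_twice(2) unfolding T_basis_def by metis+
  have "gen_times n i h x =
      (\<Sum>w | w permutes {1..n}. (if w = ?s x then h w * (if left_ascent i w then 1 else hecke_q) else 0) +
         (if w = x then (if left_ascent i w then 0 else h w * (hecke_q - 1)) else 0))"
    unfolding gen_times_def carrier_sym_group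
  proof (rule sum.cong)
    fix w
    assume "w \<in> {w. w permutes {1..n}}"
    then have "gen_times_T n i w x =
        (if left_ascent i w then (if w = ?s x then 1 else 0)
         else hecke_q * (if w = ?s x then 1 else 0) + (hecke_q - 1) * (if w = x then 1 else 0))"
      by (cases "left_ascent i w")
         (simp_all only: gen_times_T_def perm_length_left_less_iff[OF _ i] if_True if_False T[of w] mem_Collect_eq)
    then show "h w * gen_times_T n i w x =
        (if w = ?s x then h w * (if left_ascent i w then 1 else hecke_q) else 0) +
        (if w = x then (if left_ascent i w then 0 else h w * (hecke_q - 1)) else 0)"
      by (simp add: algebra_simps)
  qed simp
  also have "\<dots> = h (?s x) * (if left_ascent i (?s x) then 1 else hecke_q) +
      (if left_ascent i x then 0 else h x * (hecke_q - 1))"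
    using x left_mult_permutes[OF i, of x] by (simp add: sum.distrib sum.delta)
  finally show ?thesis
    by (simp add: left_ascent_left_mult[OF x] mult.commute)
qed

lemma gen_times_outside:
  assumes "i \<in> {1..<n}" and "\<not> x permutes {1..n}"
  shows "gen_times n i h x = 0"
  unfolding gen_times_def
proof (rule sum.neutral, rule ballI)
  fix w assume "w \<in> carrier (sym_group n)"
  then have "x \<noteq> w" "x \<noteq> adj_transp i \<circ> w"
    using assms left_mult_permutes[OF assms(1), of w] by (auto simp: carrier_sym_group)
  then show "h w * gen_times_T n i w x = 0"
    by (simp add: gen_times_T_def T_basis_def)
qed

lemma gen_times_in_carrier: "i \<in> {1..<n} \<Longrightarrow> gen_times n i h \<in> carrier (hecke n)"
  unfolding hecke_carrier_iff using gen_times_outside by blast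

lemma gen_times_T_basis:
  assumes "w permutes {1..n}"
  shows "gen_times n i (T_basis w) = gen_times_T n i w"
proof
  fix x
  have "gen_times n i (T_basis w) x = (\<Sum>u | u permutes {1..n}. if u = w then gen_times_T n i w x else 0)"
    unfolding gen_times_def carrier_sym_group by (rule sum.cong) (auto simp: T_basis_def)
  then show "gen_times n i (T_basis w) x = gen_times_T n i w x"
    using assms by (simp add: sum.delta)
qed

lemma gen_times_T_basis_ascent:
  assumes "w permutes {1..n}" "i \<in> {1..<n}" "left_ascent i w"
  shows "gen_times n i (T_basis w) = T_basis (adj_transp i \<circ> w)"
  using perm_length_left_less_iff[OF assms(1,2)] assms
  by (simp add: gen_times_T_basis gen_times_T_def)

lemma gen_times_T_basis_descent:
  assumes "w permutes {1..n}" "i \<in> {1..<n}" "\<not> left_ascent i w"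
  shows "gen_times n i (T_basis w) =
    (\<lambda>x. hecke_q * T_basis (adj_transp i \<circ> w) x + (hecke_q - 1) * T_basis w x)"
  using perm_length_left_less_iff[OF assms(1,2)] assms
  by (simp add: gen_times_T_basis gen_times_T_def)

lemma gen_times_quadratic:
  assumes h: "h \<in> carrier (hecke n)" and i: "i \<in> {1..<n}"
  shows "gen_times n i (gen_times n i h) = (\<lambda>x. (hecke_q - 1) * gen_times n i h x + hecke_q * h x)"
proof
  fix x
  show "gen_times n i (gen_times n i h) x = (hecke_q - 1) * gen_times n i h x + hecke_q * h x"
  proof (cases "x permutes {1..n}")
    case True
    then show ?thesis
      using left_mult_permutes[OF i, of x]
      by (simp add: gen_times_apply[OF _ i] left_ascent_left_mult[OF True] algebra_simps
              )
  next
    case False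
    then show ?thesis using h gen_times_outside[OF i] by (auto simp: hecke_carrier_iff)
  qed
qed

text \<open>Left multiplication by \<open>T\<^sub>s\<^sup>-\<^sup>1 = q\<^sup>-\<^sup>1 T\<^sub>s + (q\<^sup>-\<^sup>1 - 1)\<close>.\<close>

definition gen_div :: "nat \<Rightarrow> nat \<Rightarrow> hecke_elem \<Rightarrow> hecke_elem" where
  "gen_div n i h = (\<lambda>x. qhalf_power (- 2) * gen_times n i h x + (qhalf_power (- 2) - 1) * h x)"

lemma gen_div_in_carrier:
  "h \<in> carrier (hecke n) \<Longrightarrow> i \<in> {1..<n} \<Longrightarrow> gen_div n i h \<in> carrier (hecke n)"
  using gen_times_outside by (auto simp: hecke_carrier_iff gen_div_def)

lemma gen_div_add: "gen_div n i (\<lambda>x. f x + g x) = (\<lambda>x. gen_div n i f x + gen_div n i g x)"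
  by (simp add: gen_div_def gen_times_add algebra_simps)

lemma gen_div_scale: "gen_div n i (\<lambda>x. c * f x) = (\<lambda>x. c * gen_div n i f x)"
  by (simp add: gen_div_def gen_times_scale algebra_simps)

lemma gen_div_apply:
  assumes x: "x permutes {1..n}" and i: "i \<in> {1..<n}"
  shows "gen_div n i h x =
    (if left_ascent i x then h (adj_transp i \<circ> x) + (qhalf_power (- 2) - 1) * h x
     else qhalf_power (- 2) * h (adj_transp i \<circ> x))"
proof -
  have "qhalf_power (- 2) * (hecke_q * a) = a" for a
    by (simp add: mult.assoc[symmetric] q_times_inverse)
  then show ?thesis
    by (simp add: gen_div_def gen_times_apply[OF assms] algebra_simps)
qed

lemma gen_times_gen_div:
  assumes "h \<in> carrier (hecke n)" "i \<in> {1..<n}"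
  shows "gen_times n i (gen_div n i h) = h" "gen_div n i (gen_times n i h) = h"
proof -
  have *: "qhalf_power (- 2) * ((hecke_q - 1) * a + hecke_q * b) + (qhalf_power (- 2) - 1) * a = b" for a b
  proof -
    have "qhalf_power (- 2) * ((hecke_q - 1) * a + hecke_q * b) + (qhalf_power (- 2) - 1) * a =
        (qhalf_power (- 2) * hecke_q) * (a + b) - a"
      by (simp add: algebra_simps)
    then show ?thesis by (simp add: q_times_inverse)
  qed
  show "gen_times n i (gen_div n i h) = h" "gen_div n i (gen_times n i h) = h"
    unfolding gen_div_def gen_times_add gen_times_scale gen_times_quadratic[OF assms] * by (rule refl)+
qed

text \<open>Right multiplication by \<open>T\<^sub>s\<close>, given directly by its coefficients. It is an auxiliary device:
  operators that commute with all left multiplications and generate the algebra from the unit show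
  that products of left multiplications are determined by their value at the unit.\<close>

definition right_times :: "nat \<Rightarrow> nat \<Rightarrow> hecke_elem \<Rightarrow> hecke_elem" where
  "right_times n j h = (\<lambda>x. if x permutes {1..n} then
     (if x j < x (Suc j) then hecke_q * h (x \<circ> adj_transp j)
      else h (x \<circ> adj_transp j) + (hecke_q - 1) * h x) else 0)"

lemma right_times_T_basis_ascent:
  assumes w: "w permutes {1..n}" and j: "j \<in> {1..<n}" and asc: "w j < w (Suc j)"
  shows "right_times n j (T_basis w) = T_basis (w \<circ> adj_transp j)"
proof
  fix x
  have eq: "x \<circ> adj_transp j = w \<longleftrightarrow> x = w \<circ> adj_transp j"
    using adj_transp_twice(4) by metis
  have "w \<circ> adj_transp j \<noteq> w"
    using asc by (metis adj_transp_simps(1) comp_apply less_irrefl)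
  then show "right_times n j (T_basis w) x = T_basis (w \<circ> adj_transp j) x"
    using asc w right_mult_permutes[OF j, of w]
    by (auto simp: right_times_def T_basis_def eq)
qed

lemma right_times_sum:
  "right_times n j (\<lambda>x. \<Sum>a\<in>A. c a * f a x) = (\<lambda>x. \<Sum>a\<in>A. c a * right_times n j (f a) x)"
  by (auto simp: right_times_def fun_eq_iff sum_distrib_left sum.distrib[symmetric] algebra_simps)

lemma right_times_in_carrier: "right_times n j h \<in> carrier (hecke n)"
  by (simp add: hecke_carrier_iff right_times_def)

text \<open>The exchange condition for the symmetric group: \<open>s x = x t\<close> happens exactly when \<open>x\<close> maps the two
  positions moved by \<open>t\<close> to the two values moved by \<open>s\<close>.\<close>

lemma adj_transp_exchange:
  assumes x: "x permutes {1..n}"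
  shows "adj_transp i \<circ> x = x \<circ> adj_transp j \<longleftrightarrow>
    (x j = i \<and> x (Suc j) = Suc i) \<or> (x j = Suc i \<and> x (Suc j) = i)" (is "?L \<longleftrightarrow> ?R")
proof
  assume ?L
  from fun_cong[OF this, of j] have "adj_transp i (x j) = x (Suc j)" by simp
  moreover have "x j \<noteq> x (Suc j)"
    using permutes_inj[OF x] by (simp add: inj_eq)
  ultimately show ?R
    by (cases "x j = i"; cases "x j = Suc i") (auto simp: adj_transp_other)
next
  assume R: ?R
  have inj: "x a = x b \<longleftrightarrow> a = b" for a b
    using permutes_inj[OF x] by (simp add: inj_eq)
  show ?L
  proof
    fix a
    show "(adj_transp i \<circ> x) a = (x \<circ> adj_transp j) a"
    proof (cases "a = j \<or> a = Suc j")
      case True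
      then show ?thesis using R by auto
    next
      case False
      then have "x a \<noteq> i" "x a \<noteq> Suc i" using R inj by metis+
      then show ?thesis using False by (simp add: adj_transp_other)
    qed
  qed
qed

text \<open>If \<open>s x \<noteq> x t\<close>, then multiplying by \<open>t\<close> on the right does not affect whether \<open>s\<close> is a left ascent,
  and vice versa, so both sides are the same product of two independent rules. If \<open>s x = x t\<close>, the
  left and the right rule at \<open>x\<close> coincide.\<close>

lemma gen_times_right_times_commute:
  assumes i: "i \<in> {1..<n}" and j: "j \<in> {1..<n}"
  shows "gen_times n i (right_times n j h) = right_times n j (gen_times n i h)"
proof
  fix x
  let ?s = "adj_transp i" and ?t = "adj_transp j"
  show "gen_times n i (right_times n j h) x = right_times n j (gen_times n i h) x"
  proof (cases "x permutes {1..n}")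
    case x: True
    have sx: "?s \<circ> x permutes {1..n}" and xt: "x \<circ> ?t permutes {1..n}"
      using x left_mult_permutes[OF i] right_mult_permutes[OF j] by blast+
    have inv: "Hilbert_Choice.inv x a = b \<longleftrightarrow> a = x b" for a b
      by (rule inv_perm_eq_iff[OF x])
    have ne: "x j \<noteq> x (Suc j)"
      using permutes_inj[OF x] by (simp add: inj_eq)
    show ?thesis
    proof (cases "?s \<circ> x = x \<circ> ?t")
      case True
      then have "left_ascent i x \<longleftrightarrow> x j < x (Suc j)"
        using adj_transp_exchange[OF x, of i j] inv by (metis lessI not_less_iff_gr_or_eq)
      moreover have "?s \<circ> (x \<circ> ?t) = x"
        unfolding True[symmetric] by simp
      ultimately show ?thesis
        using x sx xt True left_ascent_left_mult[OF x, of i] ne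
        by (auto simp: gen_times_apply[OF _ i] right_times_def algebra_simps)
    next
      case False
      then have F: "\<not> (x j = i \<and> x (Suc j) = Suc i)" "\<not> (x j = Suc i \<and> x (Suc j) = i)"
        using adj_transp_exchange[OF x] by blast+
      have 1: "left_ascent i (x \<circ> ?t) \<longleftrightarrow> left_ascent i x"
        unfolding inv_right_mult[OF x] comp_apply adj_transp_less_iff inv using F by metis
      have 2: "(?s \<circ> x) j < (?s \<circ> x) (Suc j) \<longleftrightarrow> x j < x (Suc j)"
        unfolding comp_apply adj_transp_less_iff using F by metis
      have 3: "?s \<circ> x \<circ> ?t = ?s \<circ> (x \<circ> ?t)"
        by (rule comp_assoc)
      show ?thesis
        using x sx xt 1 2 3
        by (simp add: gen_times_apply[OF _ i] right_times_def algebra_simps del: comp_apply)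
    qed
  next
    case False
    then show ?thesis using gen_times_outside[OF i] by (simp add: right_times_def)
  qed
qed

section \<open>Words\<close>

lemma foldr_gen_times_add:
  "foldr (gen_times n) ss (\<lambda>x. f x + g x) = (\<lambda>x. foldr (gen_times n) ss f x + foldr (gen_times n) ss g x)"
  by (induction ss) (simp_all add: gen_times_add)

lemma foldr_gen_times_scale:
  "foldr (gen_times n) ss (\<lambda>x. c * f x) = (\<lambda>x. c * foldr (gen_times n) ss f x)"
  by (induction ss) (simp_all add: gen_times_scale)

lemma foldr_gen_times_zero: "foldr (gen_times n) ss (\<lambda>_. 0) = (\<lambda>_. 0)"
  by (induction ss) (simp_all add: gen_times_zero)

lemma foldr_gen_times_in_carrier:
  "h \<in> carrier (hecke n) \<Longrightarrow> set ss \<subseteq> {1..<n} \<Longrightarrow> foldr (gen_times n) ss h \<in> carrier (hecke n)"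
  by (induction ss) (auto intro!: gen_times_in_carrier)

lemma foldr_right_times_sum:
  "foldr (right_times n) js (\<lambda>x. \<Sum>a\<in>A. c a * f a x) =
   (\<lambda>x. \<Sum>a\<in>A. c a * foldr (right_times n) js (f a) x)"
  by (induction js) (simp_all add: right_times_sum)

lemma foldr_right_times_in_carrier:
  "h \<in> carrier (hecke n) \<Longrightarrow> foldr (right_times n) js h \<in> carrier (hecke n)"
  by (induction js) (auto intro!: right_times_in_carrier)

lemma foldr_gen_times_commute:
  assumes "set ss \<subseteq> {1..<n}" "set js \<subseteq> {1..<n}"
  shows "foldr (gen_times n) ss (foldr (right_times n) js h) =
    foldr (right_times n) js (foldr (gen_times n) ss h)"
proof -
  have one: "gen_times n i (foldr (right_times n) js h) = foldr (right_times n) js (gen_times n i h)"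
    if "i \<in> {1..<n}" for i h
    using assms(2) that by (induction js) (simp_all add: gen_times_right_times_commute)
  show ?thesis
    using assms(1) by (induction ss) (simp_all add: one)
qed

lemma T_basis_as_right_word:
  assumes "w permutes {1..n}"
  obtains js where "set js \<subseteq> {1..<n}" "T_basis w = foldr (right_times n) js (T_basis id)"
proof -
  have "\<exists>js. set js \<subseteq> {1..<n} \<and> T_basis w = foldr (right_times n) js (T_basis id)"
    using assms
  proof (induction rule: perm_right_induct)
    case id
    show ?case by (rule exI[of _ "[]"]) simp
  next
    case (right_mult i x)
    then obtain js where js: "set js \<subseteq> {1..<n}" "T_basis x = foldr (right_times n) js (T_basis id)"
      by blast
    then have "T_basis (x \<circ> adj_transp i) = foldr (right_times n) (i # js) (T_basis id)"
      using right_times_T_basis_ascent[OF right_mult(1-3)] by (simp only: foldr.simps comp_apply)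
    moreover have "set (i # js) \<subseteq> {1..<n}"
      using js right_mult(2) by simp
    ultimately show ?case by blast
  qed
  then show ?thesis using that by blast
qed

lemma word_product:
  assumes "set ss \<subseteq> {1..<n}"
  shows "foldr (\<lambda>i u. adj_transp i \<circ> u) ss id permutes {1..n} \<and>
    perm_length n (foldr (\<lambda>i u. adj_transp i \<circ> u) ss id) \<le> length ss"
  using assms
proof (induction ss)
  case Nil
  then show ?case by (simp add: permutes_id flip: id_def)
next
  case (Cons i ss)
  let ?u = "foldr (\<lambda>i u. adj_transp i \<circ> u) ss id"
  have u: "?u permutes {1..n}" "perm_length n ?u \<le> length ss" and i: "i \<in> {1..<n}"
    using Cons by (auto simp: comp_def id_def)
  have "perm_length n (adj_transp i \<circ> ?u) \<le> Suc (perm_length n ?u)"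
    using perm_length_left_ascent[OF u(1) i] perm_length_left_descent[OF u(1) i] by fastforce
  then show ?case
    using u left_mult_permutes[OF i, of ?u] by (simp add: comp_def id_def)
qed

lemma reduced_word_permutes: "is_reduced_word n ss u \<Longrightarrow> u permutes {1..n}"
  unfolding is_reduced_word_def using word_product by blast

text \<open>In a reduced word every letter is an ascent for the product of the letters after it, as the
  length would otherwise be too small.\<close>

lemma reduced_word_T_basis:
  assumes "is_reduced_word n ss u"
  shows "foldr (gen_times n) ss (T_basis id) = T_basis u"
  using assms
proof (induction ss arbitrary: u)
  case Nil
  then show ?case by (auto simp: is_reduced_word_def)
next
  case (Cons i ss)
  define v where "v = foldr (\<lambda>i u. adj_transp i \<circ> u) ss id"
  have i: "i \<in> {1..<n}" and ss: "set ss \<subseteq> {1..<n}" and u: "u = adj_transp i \<circ> v"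
    and len: "Suc (length ss) = perm_length n u"
    using Cons.prems by (auto simp: is_reduced_word_def v_def)
  have v: "v permutes {1..n}" "perm_length n v \<le> length ss"
    using word_product[OF ss] by (simp_all add: v_def)
  then have asc: "left_ascent i v"
    using perm_length_left_descent[OF v(1) i] len u by (auto intro: ccontr)
  then have "perm_length n v = length ss"
    using perm_length_left_ascent[OF v(1) i] len u by simp
  then have "is_reduced_word n ss v"
    using ss by (simp add: is_reduced_word_def v_def)
  then show ?case
    using Cons.IH[of v] gen_times_T_basis_ascent[OF v(1) i asc] u by (simp add: comp_def id_def)
qed

lemma exists_reduced_word:
  assumes "w permutes {1..n}"
  shows "\<exists>ss. is_reduced_word n ss w"
  using assms
proof (induction rule: perm_left_induct)
  case id
  show ?case by (rule exI[of _ "[]"]) (simp add: is_reduced_word_def flip: id_def)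
next
  case (left_mult i x)
  then obtain ss where "is_reduced_word n ss x" by blast
  then show ?case
    using left_mult perm_length_left_ascent[of x n i]
    by (intro exI[of _ "i # ss"]) (simp add: is_reduced_word_def comp_def id_def)
qed

text \<open>Two reduced words of \<open>u\<close> give operators that agree at the unit, where both give \<open>T\<^sub>u\<close>. They commute
  with right multiplications, and these carry the unit to every basis element, so the operators agree
  everywhere.\<close>

lemma reduced_word_independent:
  assumes "h \<in> carrier (hecke n)" "is_reduced_word n ss u" "is_reduced_word n ss' u"
  shows "foldr (gen_times n) ss h = foldr (gen_times n) ss' h"
  using assms(1)
proof (induction rule: hecke_span_induct)
  case (basis w)
  then obtain js where js: "set js \<subseteq> {1..<n}" "T_basis w = foldr (right_times n) js (T_basis id)"
    using T_basis_as_right_word by blast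
  have "set ss \<subseteq> {1..<n}" "set ss' \<subseteq> {1..<n}"
    using assms by (auto simp: is_reduced_word_def)
  then show ?case
    using js assms by (simp add: foldr_gen_times_commute reduced_word_T_basis)
qed (simp_all add: foldr_gen_times_add foldr_gen_times_scale foldr_gen_times_zero)

lemma T_times_reduced_word:
  assumes "h \<in> carrier (hecke n)" "is_reduced_word n ss u"
  shows "T_times n u h = foldr (gen_times n) ss h"
  unfolding T_times_def
  using reduced_word_independent[OF assms(1) someI[of "\<lambda>ss. is_reduced_word n ss u", OF assms(2)] assms(2)] .

section \<open>Inverses of the standard basis\<close>

lemma fold_gen_div_foldr_gen_times:
  assumes "set ss \<subseteq> {1..<n}" "h \<in> carrier (hecke n)"
  shows "fold (gen_div n) ss (foldr (gen_times n) ss h) = h"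
  using assms by (induction ss) (auto simp: gen_times_gen_div foldr_gen_times_in_carrier)

lemma foldr_gen_times_fold_gen_div:
  assumes "set ss \<subseteq> {1..<n}" "h \<in> carrier (hecke n)"
  shows "foldr (gen_times n) ss (fold (gen_div n) ss h) = h"
  using assms by (induction ss arbitrary: h) (auto simp: gen_times_gen_div gen_div_in_carrier)

lemma fold_gen_div_in_carrier:
  assumes "set ss \<subseteq> {1..<n}" "h \<in> carrier (hecke n)"
  shows "fold (gen_div n) ss h \<in> carrier (hecke n)"
  using assms by (induction ss arbitrary: h) (auto simp: gen_div_in_carrier)

lemma hecke_mult_T_basis_left:
  assumes "u permutes {1..n}"
  shows "hecke_mult n (T_basis u) h = T_times n u h"
proof
  fix x
  have "hecke_mult n (T_basis u) h x = (\<Sum>v | v permutes {1..n}. if v = u then T_times n u h x else 0)"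
    unfolding hecke_mult_def carrier_sym_group by (rule sum.cong) (auto simp: T_basis_def)
  then show "hecke_mult n (T_basis u) h x = T_times n u h x"
    using assms by (simp add: sum.delta)
qed

text \<open>By linearity \<open>h\<close> may be taken from the standard basis, and right multiplications commute with the left
  multiplications that define the product. With \<open>T_basis_as_right_word\<close> this identifies right
  multiplication by \<open>T\<^sub>u\<close>.\<close>

lemma hecke_mult_right_word:
  assumes "h \<in> carrier (hecke n)" "set js \<subseteq> {1..<n}"
  shows "hecke_mult n h (foldr (right_times n) js (T_basis id)) = foldr (right_times n) js h"
proof -
  have *: "T_times n v (foldr (right_times n) js (T_basis id)) = foldr (right_times n) js (T_basis v)"
    if v: "v permutes {1..n}" for v
  proof -
    obtain ss where ss: "is_reduced_word n ss v" using exists_reduced_word[OF v] by blast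
    have "foldr (right_times n) js (T_basis id) \<in> carrier (hecke n)"
      by (intro foldr_right_times_in_carrier T_basis_in_carrier permutes_id)
    moreover have "set ss \<subseteq> {1..<n}" using ss by (simp add: is_reduced_word_def)
    ultimately show ?thesis
      using T_times_reduced_word[OF _ ss] foldr_gen_times_commute[OF _ assms(2)]
        reduced_word_T_basis[OF ss] by simp
  qed
  have "hecke_mult n h (foldr (right_times n) js (T_basis id)) =
      (\<lambda>x. \<Sum>v | v permutes {1..n}. h v * foldr (right_times n) js (T_basis v) x)"
    unfolding hecke_mult_def carrier_sym_group
    by (rule ext, rule sum.cong) (simp_all add: *)
  also have "\<dots> = foldr (right_times n) js (\<lambda>x. \<Sum>v | v permutes {1..n}. h v * T_basis v x)"
    by (rule foldr_right_times_sum[symmetric])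
  finally show ?thesis
    using hecke_elem_expansion[OF assms(1)] by simp
qed

text \<open>The operator of left multiplication by \<open>T\<^sub>u\<close> is invertible, so a right inverse \<open>y\<close> of \<open>T\<^sub>u\<close> exists and
  is unique. It is also a left inverse: right multiplication by \<open>T\<^sub>u\<close> commutes with the inverse
  operator, so it sends \<open>y\<close> to the image of \<open>T\<^sub>u\<close> under that operator, which is the unit.\<close>

lemma inverse_T_basis:
  assumes ss: "is_reduced_word n ss u"
  shows "inv\<^bsub>hecke n\<^esub> (T_basis u) = fold (gen_div n) ss (T_basis id)"
proof -
  let ?y = "fold (gen_div n) ss (T_basis id)"
  have u: "u permutes {1..n}" using ss by (rule reduced_word_permutes)
  have s: "set ss \<subseteq> {1..<n}" using ss by (simp add: is_reduced_word_def)
  have id: "T_basis id \<in> carrier (hecke n)"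
    by (intro T_basis_in_carrier permutes_id)
  have y: "?y \<in> carrier (hecke n)"
    by (rule fold_gen_div_in_carrier[OF s id])
  have left: "hecke_mult n (T_basis u) y = foldr (gen_times n) ss y" if "y \<in> carrier (hecke n)" for y
    using T_times_reduced_word[OF that ss] hecke_mult_T_basis_left[OF u] by simp
  obtain js where js: "set js \<subseteq> {1..<n}" "T_basis u = foldr (right_times n) js (T_basis id)"
    using T_basis_as_right_word[OF u] by blast
  \<comment> \<open>Right multiplication by \<open>T\<^sub>u\<close> is \<open>foldr (right_times n) js\<close>; move it past the word \<open>ss\<close>.\<close>
  have "foldr (gen_times n) ss (foldr (right_times n) js ?y) = foldr (right_times n) js (T_basis id)"
    using foldr_gen_times_commute[OF s js(1)] foldr_gen_times_fold_gen_div[OF s id] by simp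
  also have "\<dots> = foldr (gen_times n) ss (T_basis id)"
    using js(2) reduced_word_T_basis[OF ss] by simp
  finally have "foldr (right_times n) js ?y = T_basis id"
    using fold_gen_div_foldr_gen_times[OF s] foldr_right_times_in_carrier[OF y] id by metis
  then have right: "hecke_mult n ?y (T_basis u) = T_basis id"
    unfolding js(2) using hecke_mult_right_word[OF y js(1)] by simp
  have "(THE y. y \<in> carrier (hecke n) \<and> hecke_mult n (T_basis u) y = T_basis id \<and>
      hecke_mult n y (T_basis u) = T_basis id) = ?y"
  proof (rule the_equality)
    show "?y \<in> carrier (hecke n) \<and> hecke_mult n (T_basis u) ?y = T_basis id \<and>
      hecke_mult n ?y (T_basis u) = T_basis id"
      using y right left[OF y] foldr_gen_times_fold_gen_div[OF s id] by simp
  next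
    fix y
    assume "y \<in> carrier (hecke n) \<and> hecke_mult n (T_basis u) y = T_basis id \<and>
      hecke_mult n y (T_basis u) = T_basis id"
    then show "y = ?y"
      using left[of y] fold_gen_div_foldr_gen_times[OF s, of y] by simp
  qed
  then show ?thesis
    by (simp add: m_inv_def hecke_def)
qed

section \<open>The bar involution\<close>

definition bar_T :: "nat \<Rightarrow> perm \<Rightarrow> hecke_elem" where
  "bar_T n w = inv\<^bsub>hecke n\<^esub> (T_basis (Hilbert_Choice.inv w))"

lemma bar_T_id: "bar_T n id = T_basis id"
  using inverse_T_basis[of n "[]" id] by (simp add: bar_T_def is_reduced_word_def)

text \<open>The inverse of \<open>s w\<close> has a reduced word that ends in \<open>s\<close>, and inverting the product moves this letter
  to the front: \<open>bar T\<^sub>s\<^sub>w = T\<^sub>s\<^sup>-\<^sup>1 (bar T\<^sub>w)\<close>.\<close>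

lemma bar_T_left_ascent:
  assumes w: "w permutes {1..n}" and i: "i \<in> {1..<n}" and asc: "left_ascent i w"
  shows "bar_T n (adj_transp i \<circ> w) = gen_div n i (bar_T n w)"
proof -
  obtain ss where ss: "is_reduced_word n ss (Hilbert_Choice.inv w)"
    using exists_reduced_word[OF permutes_inv[OF w]] by blast
  have foldr_comp: "foldr (\<lambda>i u. adj_transp i \<circ> u) ss v = foldr (\<lambda>i u. adj_transp i \<circ> u) ss id \<circ> v" for v
    by (induction ss) (simp_all add: comp_assoc)
  have "perm_length n (Hilbert_Choice.inv (adj_transp i \<circ> w)) = Suc (perm_length n (Hilbert_Choice.inv w))"
    using perm_length_left_ascent[OF assms] perm_length_inv[OF w]
      perm_length_inv[of "adj_transp i \<circ> w" n] left_mult_permutes[OF i, of w] w by simp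
  then have "is_reduced_word n (ss @ [i]) (Hilbert_Choice.inv (adj_transp i \<circ> w))"
    using ss i foldr_comp[of "adj_transp i"] by (simp add: is_reduced_word_def inv_left_mult[OF w])
  then show ?thesis
    unfolding bar_T_def using inverse_T_basis[OF ss] inverse_T_basis by simp
qed

lemma bar_T_in_carrier:
  assumes "w permutes {1..n}"
  shows "bar_T n w \<in> carrier (hecke n)"
  using assms
proof (induction rule: perm_left_induct)
  case id
  show ?case using bar_T_id T_basis_in_carrier[OF permutes_id] by (metis id_apply)
next
  case (left_mult i x)
  then show ?case using bar_T_left_ascent[of x n i] gen_div_in_carrier by (simp add: comp_def)
qed

lemma hecke_bar_expand:
  "hecke_bar n h x = (\<Sum>w | w permutes {1..n}. laurent_bar (h w) * bar_T n w x)"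
  unfolding hecke_bar_def carrier_sym_group bar_T_def
  by (rule sum.cong) (simp_all add: carrier_sym_group)

lemma hecke_bar_add: "hecke_bar n (\<lambda>x. f x + g x) = (\<lambda>x. hecke_bar n f x + hecke_bar n g x)"
  by (simp add: fun_eq_iff hecke_bar_expand laurent_bar_add distrib_right sum.distrib)

lemma hecke_bar_diff: "hecke_bar n (\<lambda>x. f x - g x) = (\<lambda>x. hecke_bar n f x - hecke_bar n g x)"
  by (simp add: fun_eq_iff hecke_bar_expand laurent_bar_diff left_diff_distrib sum_subtractf)

lemma hecke_bar_scale: "hecke_bar n (\<lambda>x. c * f x) = (\<lambda>x. laurent_bar c * hecke_bar n f x)"
  by (simp add: fun_eq_iff hecke_bar_expand laurent_bar_mult sum_distrib_left mult.assoc)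

lemma hecke_bar_zero: "hecke_bar n (\<lambda>_. 0) = (\<lambda>_. 0)"
  by (simp add: fun_eq_iff hecke_bar_expand)

lemma hecke_bar_T_basis:
  assumes "w permutes {1..n}"
  shows "hecke_bar n (T_basis w) = bar_T n w"
proof
  fix x
  have "hecke_bar n (T_basis w) x = (\<Sum>u | u permutes {1..n}. if u = w then bar_T n w x else 0)"
    unfolding hecke_bar_expand by (rule sum.cong) (auto simp: T_basis_def)
  then show "hecke_bar n (T_basis w) x = bar_T n w x"
    using assms by (simp add: sum.delta)
qed

lemma hecke_bar_in_carrier: "hecke_bar n h \<in> carrier (hecke n)"
  unfolding hecke_carrier_iff hecke_bar_expand
  using bar_T_in_carrier by (auto intro!: sum.neutral simp: hecke_carrier_iff)

text \<open>The bar involution turns left multiplication by \<open>T\<^sub>s\<close> into left multiplication by its inverse.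
  Consequently \<open>q\<^sup>-\<^sup>1\<^sup>/\<^sup>2 (T\<^sub>s + 1)\<close> preserves invariant elements.\<close>

lemma hecke_bar_gen_times:
  assumes "h \<in> carrier (hecke n)" and i: "i \<in> {1..<n}"
  shows "hecke_bar n (gen_times n i h) = gen_div n i (hecke_bar n h)"
  using assms(1)
proof (induction rule: hecke_span_induct)
  case zero
  show ?case by (simp add: gen_times_zero hecke_bar_zero gen_div_def)
next
  case (add f g)
  then show ?case by (simp add: gen_times_add hecke_bar_add gen_div_add)
next
  case (scale c f)
  then show ?case by (simp add: gen_times_scale hecke_bar_scale gen_div_scale)
next
  case (basis w)
  show ?case
  proof (cases "left_ascent i w")
    case True
    then show ?thesis
      using basis left_mult_permutes[OF i, of w]
      by (simp add: gen_times_T_basis_ascent[OF basis i] hecke_bar_T_basis bar_T_left_ascent[OF basis i])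
  next
    case False
    define v where "v = adj_transp i \<circ> w"
    have v: "v permutes {1..n}" "left_ascent i v" "adj_transp i \<circ> v = w"
      using basis False left_mult_permutes[OF i] left_ascent_left_mult[OF basis] by (auto simp: v_def)
    have w: "bar_T n w = gen_div n i (bar_T n v)"
      using bar_T_left_ascent[OF v(1) i v(2)] v(3) by simp
    have "hecke_bar n (gen_times n i (T_basis w)) =
        (\<lambda>x. qhalf_power (- 2) * bar_T n v x + (qhalf_power (- 2) - 1) * bar_T n w x)"
      unfolding gen_times_T_basis_descent[OF basis i False] hecke_bar_add hecke_bar_scale
      using basis v(1)
      by (simp add: hecke_bar_T_basis laurent_bar_diff hecke_q_def laurent_bar_qhalf_power
          v_def[symmetric])
    also have "\<dots> = gen_div n i (bar_T n w)"
      unfolding gen_div_def[of n i "bar_T n w"]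
      using gen_times_gen_div(1)[OF bar_T_in_carrier[OF v(1)] i] w by simp
    finally show ?thesis
      by (simp add: hecke_bar_T_basis[OF basis])
  qed
qed

text \<open>By \<open>bar_T_left_ascent\<close> the image of \<open>T\<^sub>w\<close> is a product of \<open>l(w)\<close> factors \<open>T\<^sub>s\<^sup>-\<^sup>1\<close>. Each of them
  raises the length of the permutations that occur by at most one, and contributes a factor \<open>q\<^sup>-\<^sup>1\<close> to the
  leading coefficient.\<close>

lemma bar_T_triangular:
  assumes "w permutes {1..n}"
  shows "bar_T n w w = qhalf_power (- 2 * int (perm_length n w)) \<and>
    (\<forall>x. bar_T n w x \<noteq> 0 \<longrightarrow> x = w \<or> perm_length n x < perm_length n w)"
  using assms
proof (induction rule: perm_left_induct)
  case id
  show ?case by (simp add: bar_T_id T_basis_def qhalf_power_zero flip: id_def)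
next
  case (left_mult i v)
  let ?w = "adj_transp i \<circ> v"
  have w: "?w permutes {1..n}" and desc: "\<not> left_ascent i ?w"
    using left_mult left_mult_permutes left_ascent_left_mult by blast+
  have len: "perm_length n ?w = Suc (perm_length n v)"
    using left_mult by (intro perm_length_left_ascent)
  have bar: "bar_T n ?w = gen_div n i (bar_T n v)"
    using left_mult by (intro bar_T_left_ascent)
  have "bar_T n ?w ?w = qhalf_power (- 2) * bar_T n v v"
    unfolding bar using gen_div_apply[OF w left_mult(2)] desc by simp
  then have 1: "bar_T n ?w ?w = qhalf_power (- 2 * int (perm_length n ?w))"
    using left_mult by (simp add: len qhalf_power_mult)
  have "x = ?w \<or> perm_length n x < perm_length n ?w" if nz: "bar_T n ?w x \<noteq> 0" for x
  proof -
    have x: "x permutes {1..n}"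
      using bar_T_in_carrier[OF w] nz by (auto simp: hecke_carrier_iff)
    have "bar_T n v (adj_transp i \<circ> x) \<noteq> 0 \<or> (left_ascent i x \<and> bar_T n v x \<noteq> 0)"
      using nz gen_div_apply[OF x left_mult(2), of "bar_T n v"] by (auto simp: bar split: if_splits)
    then show ?thesis
    proof
      assume "bar_T n v (adj_transp i \<circ> x) \<noteq> 0"
      then consider "adj_transp i \<circ> x = v" | "perm_length n (adj_transp i \<circ> x) < perm_length n v"
        using left_mult by blast
      then show ?thesis
      proof cases
        case 1
        then have "x = ?w" by (metis adj_transp_twice(2))
        then show ?thesis by simp
      next
        case 2
        then show ?thesis
          using perm_length_left_ascent[OF x left_mult(2)] perm_length_left_descent[OF x left_mult(2)]
          unfolding len by (cases "left_ascent i x") linarith+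
      qed
    next
      assume "left_ascent i x \<and> bar_T n v x \<noteq> 0"
      then have "x = v \<or> perm_length n x < perm_length n v"
        using left_mult by blast
      then show ?thesis using len by auto
    qed
  qed
  with 1 show ?case by blast
qed

section \<open>Uniqueness of the Kazhdan--Lusztig polynomials\<close>

lemma lookup_mult_qhalf_power:
  "Poly_Mapping.lookup (f * qhalf_power k) j = Poly_Mapping.lookup f (j - k)"
proof (induction f rule: frag_induction[OF subset_UNIV])
  case (2 a)
  show ?case by (auto simp: qhalf_power_def mult_single lookup_single when_def)
qed (simp_all add: lookup_minus left_diff_distrib)

text \<open>Look at a support element \<open>y\<close> of maximal length. By triangularity only \<open>T\<^sub>y\<close> itself contributes to
  the coefficient of the bar image at \<open>y\<close>, so \<open>q\<^sup>l\<^sup>/\<^sup>2 h(y)\<close>, with \<open>l\<close> the length of \<open>y\<close>, is invariant under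
  inverting \<open>q\<close>. All its exponents are negative by hypothesis, hence it vanishes.\<close>

lemma bar_invariant_eq_zero:
  assumes h: "h \<in> carrier (hecke n)" and inv: "hecke_bar n h = h"
    and deg: "\<And>x j. Poly_Mapping.lookup (h x) j \<noteq> 0 \<Longrightarrow> j < - int (perm_length n x)"
  shows "h x = 0"
proof (rule ccontr)
  let ?S = "{x. x permutes {1..n} \<and> h x \<noteq> 0}"
  assume "h x \<noteq> 0"
  then have "?S \<noteq> {}"
    using h by (auto simp: hecke_carrier_iff)
  moreover have fin: "finite ?S"
    by (rule finite_subset[OF _ finite_perms[of n]]) auto
  ultimately obtain y where y: "y \<in> ?S" and max: "\<And>z. z \<in> ?S \<Longrightarrow> perm_length n z \<le> perm_length n y"
    using finite_has_maximal[of "perm_length n ` ?S"] by fastforce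
  have "hecke_bar n h y = (\<Sum>w | w permutes {1..n}. if w = y then laurent_bar (h y) * bar_T n y y else 0)"
    unfolding hecke_bar_expand
  proof (rule sum.cong)
    fix w
    assume w: "w \<in> {w. w permutes {1..n}}"
    \<comment> \<open>A nonzero coefficient would make \<open>w\<close> a longer element of the support.\<close>
    have "bar_T n w y = 0" if "w \<noteq> y" "h w \<noteq> 0"
      using bar_T_triangular[of w n] max[of w] w that by fastforce
    then show "laurent_bar (h w) * bar_T n w y = (if w = y then laurent_bar (h y) * bar_T n y y else 0)"
      by (cases "h w = 0") auto
  qed simp
  then have "h y = laurent_bar (h y) * qhalf_power (- 2 * int (perm_length n y))"
    using y inv bar_T_triangular[of y n] by (simp add: sum.delta)
  then have sym: "Poly_Mapping.lookup (h y) j = Poly_Mapping.lookup (h y) (- j - 2 * int (perm_length n y))" for j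
    by (metis (no_types, lifting) ab_group_add_class.ab_diff_conv_add_uminus add.commute
        add_diff_cancel diff_minus_eq_add lookup_laurent_bar lookup_mult_qhalf_power minus_add
        minus_mult_left)
  obtain j where j: "Poly_Mapping.lookup (h y) j \<noteq> 0"
    using y by (auto simp: poly_mapping_eq_iff fun_eq_iff)
  from deg[OF this] deg[of y "- j - 2 * int (perm_length n y)"] j sym[of j] show False
    by linarith
qed

text \<open>The difference of two candidates loses the common leading coefficient \<open>1\<close> at \<open>w\<close>, and at all other
  places the degree condition is exactly the bound required by \<open>bar_invariant_eq_zero\<close>.\<close>

lemma KL_family_unique:
  assumes P: "is_KL_family n w P" and R: "is_KL_family n w R"
  shows "P = R"
proof
  fix x
  let ?h = "\<lambda>x. KL_elem n w P x - KL_elem n w R x"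
  let ?l = "int (perm_length n w)"
  have outside: "P x = 0 \<and> R x = 0" if "\<not> bruhat_le n x w" for x
    using that P R by (simp add: is_KL_family_def)
  have carrier: "?h \<in> carrier (hecke n)"
    using outside by (auto simp: hecke_carrier_iff KL_elem_def bruhat_le_def carrier_sym_group)
  have "hecke_bar n ?h = ?h"
    unfolding hecke_bar_diff using P R by (simp add: is_KL_family_def)
  moreover have "j < - int (perm_length n x)" if nz: "Poly_Mapping.lookup (?h x) j \<noteq> 0" for x j
  proof -
    have "?h x = (poly_in_q (P x) - poly_in_q (R x)) * qhalf_power (- ?l)"
      by (simp add: KL_elem_def algebra_simps)
    with nz have nz': "Poly_Mapping.lookup (poly_in_q (P x)) (j + ?l) \<noteq> Poly_Mapping.lookup (poly_in_q (R x)) (j + ?l)"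
      by (simp add: lookup_mult_qhalf_power lookup_minus)
    have "bruhat_le n x w"
      using nz' outside[of x] by metis
    moreover have "x \<noteq> w"
      using nz' P R unfolding is_KL_family_def by metis
    ultimately
    have "2 * degree (P x) + perm_length n x + 1 \<le> perm_length n w"
        "2 * degree (R x) + perm_length n x + 1 \<le> perm_length n w"
      using P R by (auto simp: is_KL_family_def)
    moreover have "j + ?l \<le> 2 * int (degree (P x)) \<or> j + ?l \<le> 2 * int (degree (R x))"
      using nz' lookup_poly_in_q_high by (metis not_le)
    ultimately show ?thesis by linarith
  qed
  ultimately have "?h x = 0"
    using bar_invariant_eq_zero[OF carrier] by blast
  then have "qhalf_power ?l * (qhalf_power (- ?l) * poly_in_q (P x)) =
      qhalf_power ?l * (qhalf_power (- ?l) * poly_in_q (R x))"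
    by (simp add: KL_elem_def)
  then show "P x = R x"
    by (simp add: mult.assoc[symmetric] qhalf_power_mult qhalf_power_zero poly_in_q_inject)
qed

lemma KL_poly_eqI:
  assumes "is_KL_family n w P"
  shows "KL_poly n x w = P x"
  unfolding KL_poly_def using the_equality[of "is_KL_family n w" P] assms KL_family_unique by metis

section \<open>Self-dual elements\<close>

text \<open>This says that \<open>q\<^sup>-\<^sup>N\<^sup>/\<^sup>2 h\<close> is invariant under the bar involution. Carrying the exponent \<open>N\<close> separately
  keeps half-integral powers out of the calculations; for the Schubert varieties below,
  \<open>N\<close> is the length of the longest permutation that occurs.\<close>

definition self_dual :: "nat \<Rightarrow> int \<Rightarrow> hecke_elem \<Rightarrow> bool" where
  "self_dual n N h \<longleftrightarrow> h \<in> carrier (hecke n) \<and> hecke_bar n h = (\<lambda>x. qhalf_power (- 2 * N) * h x)"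

lemma self_dual_zero: "self_dual n N (\<lambda>_. 0)"
  by (simp add: self_dual_def hecke_carrier_iff hecke_bar_zero)

lemma self_dual_diff:
  assumes "self_dual n N f" "self_dual n N g"
  shows "self_dual n N (\<lambda>x. f x - g x)"
  using assms by (simp add: self_dual_def hecke_carrier_iff hecke_bar_diff algebra_simps)

lemma self_dual_scale:
  assumes "self_dual n N h" and "laurent_bar c = qhalf_power (- 2 * M) * c"
  shows "self_dual n (N + M) (\<lambda>x. c * h x)"
proof -
  have "qhalf_power (- 2 * (N + M)) = qhalf_power (- 2 * M) * qhalf_power (- 2 * N)"
    by (simp add: qhalf_power_mult algebra_simps)
  then show ?thesis
    using assms by (simp add: self_dual_def hecke_carrier_iff hecke_bar_scale algebra_simps)
qed

lemma self_dual_q_scale: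
  assumes "self_dual n N h"
  shows "self_dual n (N + 2) (\<lambda>x. hecke_q * h x)"
  using assms
  by (rule self_dual_scale) (simp add: hecke_q_def laurent_bar_qhalf_power qhalf_power_mult)

text \<open>Since \<open>1 + T\<^sub>s\<^sup>-\<^sup>1 = q\<^sup>-\<^sup>1 (1 + T\<^sub>s)\<close>, one more factor \<open>q\<^sup>-\<^sup>1\<close> appears; geometrically, passing to a
  bundle of projective lines raises the dimension by one.\<close>

lemma self_dual_gen_times:
  assumes h: "self_dual n N h" and i: "i \<in> {1..<n}"
  shows "self_dual n (N + 1) (\<lambda>x. h x + gen_times n i h x)"
proof -
  have "qhalf_power (- 2 * (N + 1)) = qhalf_power (- 2) * qhalf_power (- 2 * N)"
    by (simp add: qhalf_power_mult algebra_simps)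
  moreover have "h \<in> carrier (hecke n)" "hecke_bar n h = (\<lambda>x. qhalf_power (- 2 * N) * h x)"
    using h by (simp_all add: self_dual_def)
  ultimately show ?thesis
    using gen_times_in_carrier[OF i, of h]
    by (simp add: self_dual_def hecke_bar_add hecke_bar_gen_times[OF _ i] gen_div_scale)
       (simp add: gen_div_def hecke_carrier_iff algebra_simps)
qed

section \<open>Cosets of the parabolic subgroup\<close>

text \<open>The sum of the \<open>T\<^sub>x\<close> over one left coset of the parabolic subgroup that stabilises \<open>{1..k}\<close>. Such cosets
  are indexed by the \<open>k\<close>-subsets \<open>V\<close>, which are the cells of the Grassmannian.\<close>

definition cell_sum :: "nat \<Rightarrow> nat \<Rightarrow> nat set \<Rightarrow> hecke_elem" where
  "cell_sum n k V = (\<lambda>x. if x permutes {1..n} \<and> x ` {1..k} = V then 1 else 0)"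

lemma cell_sum_in_carrier: "cell_sum n k V \<in> carrier (hecke n)"
  by (simp add: hecke_carrier_iff cell_sum_def)

lemma mem_image_iff_inv_le:
  assumes "x permutes {1..n}" "a \<in> {1..n}" "k \<le> n"
  shows "a \<in> x ` {1..k} \<longleftrightarrow> Hilbert_Choice.inv x a \<le> k"
proof
  assume "a \<in> x ` {1..k}"
  then show "Hilbert_Choice.inv x a \<le> k"
    using permutes_inverses(2)[OF assms(1)] by auto
next
  assume "Hilbert_Choice.inv x a \<le> k"
  moreover have "Hilbert_Choice.inv x a \<in> {1..n}"
    using perm_range[OF permutes_inv[OF assms(1)]] assms(2) by blast
  ultimately show "a \<in> x ` {1..k}"
    using permutes_inverses(1)[OF assms(1), of a] by (intro image_eqI[of _ _ "Hilbert_Choice.inv x a"]) auto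
qed

lemma adj_transp_image_fixed:
  assumes "i \<in> V \<longleftrightarrow> Suc i \<in> V"
  shows "adj_transp i ` V = V"
proof -
  have "adj_transp i a \<in> V \<longleftrightarrow> a \<in> V" for a
    using assms by (auto simp: adj_transp_def transpose_def)
  then show ?thesis
    by (metis (no_types, lifting) adj_transp_twice(1) image_eqI image_subsetI subsetI subset_antisym)
qed

lemma adj_transp_image_moved:
  assumes "i \<in> V" "Suc i \<notin> V"
  shows "adj_transp i ` V = insert (Suc i) (V - {i})"
proof -
  have "adj_transp i ` V = adj_transp i ` (insert i (V - {i}))"
    using assms by (simp add: insert_absorb)
  also have "\<dots> = insert (Suc i) ((\<lambda>a. a) ` (V - {i}))"
    unfolding image_insert adj_transp_simps using assms
    by (intro arg_cong2[where f = insert] refl image_cong) (metis Diff_iff adj_transp_other singletonI)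
  finally show ?thesis by simp
qed

lemma left_mult_image: "(adj_transp i \<circ> x) ` A = V \<longleftrightarrow> x ` A = adj_transp i ` V"
  unfolding image_comp[symmetric]
  by (metis adj_transp_twice(3) image_comp image_id id_apply)

text \<open>If \<open>s\<close> stabilises \<open>V\<close>, left multiplication by \<open>s\<close> permutes the coset, pairing each ascent with a
  descent.\<close>

lemma cell_sum_fixed:
  assumes i: "i \<in> {1..<n}" and V: "i \<in> V \<longleftrightarrow> Suc i \<in> V"
  shows "gen_times n i (cell_sum n k V) = (\<lambda>x. hecke_q * cell_sum n k V x)"
proof
  fix x
  show "gen_times n i (cell_sum n k V) x = hecke_q * cell_sum n k V x"
  proof (cases "x permutes {1..n}")
    case True
    have "cell_sum n k V (adj_transp i \<circ> x) = cell_sum n k V x"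
      unfolding cell_sum_def left_mult_image left_mult_permutes[OF i] adj_transp_image_fixed[OF V] ..
    then show ?thesis
      by (simp add: gen_times_apply[OF True i] algebra_simps)
  next
    case False
    then show ?thesis by (simp add: gen_times_outside[OF i] cell_sum_def)
  qed
qed

text \<open>Here every element of the coset has \<open>s\<close> as left ascent, since \<open>i\<close> stands among the first \<open>k\<close> positions
  and \<open>i + 1\<close> does not. So each \<open>T\<^sub>x\<close> goes to \<open>T\<^sub>s\<^sub>x\<close>.\<close>

lemma cell_sum_moved:
  assumes i: "i \<in> {1..<n}" and k: "k \<le> n" and V: "i \<in> V" "Suc i \<notin> V"
  shows "gen_times n i (cell_sum n k V) = cell_sum n k (insert (Suc i) (V - {i}))"
proof
  fix x
  let ?V' = "insert (Suc i) (V - {i})"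
  show "gen_times n i (cell_sum n k V) x = cell_sum n k ?V' x"
  proof (cases "x permutes {1..n}")
    case True
    have le: "a \<in> x ` {1..k} \<longleftrightarrow> Hilbert_Choice.inv x a \<le> k" if "a \<in> {1..n}" for a
      using mem_image_iff_inv_le[OF True that k] .
    have le: "i \<in> x ` {1..k} \<longleftrightarrow> Hilbert_Choice.inv x i \<le> k"
        "Suc i \<in> x ` {1..k} \<longleftrightarrow> Hilbert_Choice.inv x (Suc i) \<le> k"
      using i by (auto intro!: le simp del: image_iff)
    have 1: "cell_sum n k V (adj_transp i \<circ> x) = cell_sum n k ?V' x"
      unfolding cell_sum_def left_mult_image left_mult_permutes[OF i] adj_transp_image_moved[OF V] ..
    have 2: "\<not> left_ascent i x" if "x ` {1..k} = ?V'"
      using le that by auto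
    have 3: "left_ascent i x" if "x ` {1..k} = V"
      using le that V by auto
    have 4: "V \<noteq> ?V'" using V by blast
    show ?thesis
    proof (cases "x ` {1..k} = V \<or> x ` {1..k} = ?V'")
      case True
      then show ?thesis
        using 2 3 4 \<open>x permutes {1..n}\<close>
        by (elim disjE) (simp_all add: gen_times_apply[OF \<open>x permutes {1..n}\<close> i] 1, simp_all add: cell_sum_def)
    next
      case False
      then have "cell_sum n k V x = 0" "cell_sum n k ?V' x = 0" by (auto simp: cell_sum_def)
      then show ?thesis
        by (simp add: gen_times_apply[OF \<open>x permutes {1..n}\<close> i] 1)
    qed
  next
    case False
    then show ?thesis by (simp add: gen_times_outside[OF i] cell_sum_def)
  qed
qed

section \<open>The unit coset is self-dual\<close>

text \<open>The generator \<open>k\<close> leads out of the parabolic subgroup. It is an ascent for all elements of the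
  subgroup, so it cannot occur when an element of the subgroup is built up by ascents.\<close>

lemma parabolic_step:
  assumes x: "x permutes {1..n}" and i: "i \<in> {1..<n}" and k: "k \<le> n" "1 \<le> k"
    and asc: "left_ascent i x" and img: "(adj_transp i \<circ> x) ` {1..k} = {1..k}"
  shows "i \<noteq> k" "x ` {1..k} = {1..k}"
proof -
  show "i \<noteq> k"
  proof
    assume [simp]: "i = k"
    have img': "x ` {1..k} = adj_transp k ` {1..k}"
      using img unfolding left_mult_image by simp
    also have "\<dots> = insert (Suc k) ({1..k} - {k})"
      by (rule adj_transp_image_moved) (use k in auto)
    finally have "Suc k \<in> x ` {1..k}" "k \<notin> x ` {1..k}" by auto
    moreover have "Suc k \<in> {1..n}" "k \<in> {1..n}" using i by auto
    ultimately have "Hilbert_Choice.inv x (Suc k) \<le> k" "\<not> Hilbert_Choice.inv x k \<le> k"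
      using mem_image_iff_inv_le[OF x _ k(1)] by blast+
    then show False using asc by simp
  qed
  then have "adj_transp i ` {1..k} = {1..k}"
    using i by (intro adj_transp_image_fixed) auto
  then show "x ` {1..k} = {1..k}"
    using img unfolding left_mult_image by simp
qed

lemma bar_T_parabolic_support:
  assumes k: "k \<le> n" "1 \<le> k" and w: "w permutes {1..n}"
    and "w ` {1..k} = {1..k}" "bar_T n w x \<noteq> 0"
  shows "x ` {1..k} = {1..k}"
proof -
  have "w ` {1..k} = {1..k} \<longrightarrow> (\<forall>x. bar_T n w x \<noteq> 0 \<longrightarrow> x ` {1..k} = {1..k})"
    using w
  proof (induction rule: perm_left_induct)
    case id
    have "bar_T n id x \<noteq> 0 \<longrightarrow> x ` {1..k} = {1..k}" for x
      by (auto simp: bar_T_id T_basis_def)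
    then show ?case by (simp flip: id_def)
  next
    case (left_mult i v)
    have "x ` {1..k} = {1..k}"
      if img: "(adj_transp i \<circ> v) ` {1..k} = {1..k}" and nz: "bar_T n (adj_transp i \<circ> v) x \<noteq> 0" for x
    proof -
      have v: "i \<noteq> k" "v ` {1..k} = {1..k}"
        using parabolic_step[OF left_mult(1,2) k left_mult(3) img] by auto
      have w: "adj_transp i \<circ> v permutes {1..n}"
        using left_mult(1) left_mult_permutes[OF left_mult(2)] by blast
      have x: "x permutes {1..n}"
        using bar_T_in_carrier[OF w] nz by (auto simp: hecke_carrier_iff)
      have fixed: "adj_transp i ` {1..k} = {1..k}"
        using v(1) left_mult(2) by (intro adj_transp_image_fixed) auto
      have "bar_T n v (adj_transp i \<circ> x) \<noteq> 0 \<or> bar_T n v x \<noteq> 0"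
        using nz gen_div_apply[OF x left_mult(2), of "bar_T n v"]
        by (auto simp: bar_T_left_ascent[OF left_mult(1-3)] split: if_splits)
      then have "(adj_transp i \<circ> x) ` {1..k} = {1..k} \<or> x ` {1..k} = {1..k}"
        using left_mult(4) v(2) by blast
      then show ?thesis
        unfolding left_mult_image fixed by blast
    qed
    then show ?case by blast
  qed
  then show ?thesis using assms by blast
qed

text \<open>Let \<open>F\<close> be the bar image of the sum over the parabolic subgroup. Since \<open>T\<^sub>s\<close> acts on the sum by \<open>q\<close>
  for every generator \<open>s\<close> of the subgroup, \<open>T\<^sub>s\<^sup>-\<^sup>1\<close> acts on \<open>F\<close> by \<open>q\<^sup>-\<^sup>1\<close>, which forces \<open>F\<close> to be constant on
  the subgroup. It vanishes outside, and its value can be read off at the longest element, to which only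
  the leading term of one bar image contributes.\<close>

lemma self_dual_parabolic:
  assumes k: "k \<le> n" "1 \<le> k" and w0: "w0 permutes {1..n}" "w0 ` {1..k} = {1..k}"
    and longest: "\<And>x. x permutes {1..n} \<Longrightarrow> x ` {1..k} = {1..k} \<Longrightarrow> perm_length n x \<le> perm_length n w0"
  shows "self_dual n (int (perm_length n w0)) (cell_sum n k {1..k})"
proof -
  let ?e = "cell_sum n k {1..k}"
  define F where "F = hecke_bar n ?e"
  have F_expand: "F x = (\<Sum>w | w permutes {1..n}. laurent_bar (?e w) * bar_T n w x)" for x
    unfolding F_def by (rule hecke_bar_expand)
  have F_support: "F x = 0" if "\<not> (x permutes {1..n} \<and> x ` {1..k} = {1..k})" for x
  proof (cases "x permutes {1..n}")
    case True
    have "laurent_bar (?e w) * bar_T n w x = 0" if "w permutes {1..n}" for w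
    proof (cases "w ` {1..k} = {1..k}")
      case True
      then have "bar_T n w x = 0"
        using bar_T_parabolic_support[OF k \<open>w permutes {1..n}\<close>]
          \<open>\<not> (x permutes {1..n} \<and> x ` {1..k} = {1..k})\<close> \<open>x permutes {1..n}\<close> by blast
      then show ?thesis by simp
    next
      case False
      then show ?thesis by (simp add: cell_sum_def)
    qed
    then show ?thesis
      unfolding F_expand by (intro sum.neutral) blast
  next
    case False
    then show ?thesis using hecke_bar_in_carrier[of n ?e] by (simp add: hecke_carrier_iff F_def)
  qed
  have F_step: "F (adj_transp i \<circ> x) = F x"
    if x: "x permutes {1..n}" and i: "i \<in> {1..<n}" "i \<noteq> k" and asc: "left_ascent i x" for x i
  proof -
    have "gen_times n i ?e = (\<lambda>x. hecke_q * ?e x)"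
      using i by (intro cell_sum_fixed) auto
    then have "gen_div n i F = (\<lambda>x. qhalf_power (- 2) * F x)"
      unfolding F_def hecke_bar_gen_times[OF cell_sum_in_carrier i(1), symmetric]
      by (simp add: hecke_bar_scale hecke_q_def laurent_bar_qhalf_power)
    then have "qhalf_power (- 2) * F x = F (adj_transp i \<circ> x) + (qhalf_power (- 2) - 1) * F x"
      using gen_div_apply[OF x i(1), of F] asc by simp
    then show ?thesis by (simp add: algebra_simps)
  qed
  have F_const: "x ` {1..k} = {1..k} \<longrightarrow> F x = F id" if "x permutes {1..n}" for x
    using that
  proof (induction rule: perm_left_induct)
    case id
    show ?case by (simp flip: id_def)
  next
    case (left_mult i x)
    have "F (adj_transp i \<circ> x) = F id" if img: "(adj_transp i \<circ> x) ` {1..k} = {1..k}"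
      using parabolic_step[OF left_mult(1,2) k left_mult(3) img] F_step[OF left_mult(1,2) _ left_mult(3)]
        left_mult(4) by (simp flip: id_def)
    then show ?case by blast
  qed
  have "F w0 = (\<Sum>w | w permutes {1..n}. if w = w0 then bar_T n w0 w0 else 0)"
    unfolding F_expand
  proof (rule sum.cong)
    fix w
    assume w: "w \<in> {w. w permutes {1..n}}"
    show "laurent_bar (?e w) * bar_T n w w0 = (if w = w0 then bar_T n w0 w0 else 0)"
    proof (cases "w ` {1..k} = {1..k} \<and> w \<noteq> w0")
      case True
      then have "perm_length n w \<le> perm_length n w0" "w0 \<noteq> w"
        using longest w by auto
      then have "bar_T n w w0 = 0"
        using bar_T_triangular[of w n] w by (metis mem_Collect_eq not_le)
      then show ?thesis using True by simp
    next
      case False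
      then consider "w = w0" | "w \<noteq> w0" "w ` {1..k} \<noteq> {1..k}" by blast
      then show ?thesis using w0 by cases (simp_all add: cell_sum_def)
    qed
  qed simp
  then have F_w0: "F w0 = qhalf_power (- 2 * int (perm_length n w0))"
    using w0 bar_T_triangular[of w0 n] by (simp add: sum.delta)
  have "F x = qhalf_power (- 2 * int (perm_length n w0)) * ?e x" for x
  proof (cases "x permutes {1..n} \<and> x ` {1..k} = {1..k}")
    case True
    then show ?thesis
      using F_const[of x] F_const[of w0] w0 F_w0 by (simp add: cell_sum_def)
  next
    case False
    then have "?e x = 0" by (simp only: cell_sum_def if_False)
    then show ?thesis using F_support[OF False] by simp
  qed
  then show ?thesis
    unfolding self_dual_def F_def[symmetric] using cell_sum_in_carrier by blast
qed

section \<open>The Schubert variety of subspaces exchanging at most one dimension\<close>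

text \<open>The subset obtained from \<open>{1..k}\<close> by replacing \<open>a \<le> k\<close> by \<open>b > k\<close>. The choice \<open>a = b = k\<close> gives \<open>{1..k}\<close>
  back, so that the cell of the identity is the first member of the column \<open>a = k\<close>.\<close>

definition exchange :: "nat \<Rightarrow> nat \<Rightarrow> nat \<Rightarrow> nat set" where
  "exchange k a b = insert b ({1..k} - {a})"

lemma exchange_self: "1 \<le> k \<Longrightarrow> exchange k k k = {1..k}"
  by (auto simp: exchange_def)

lemma gen_times_sum:
  "gen_times n i (\<lambda>x. \<Sum>a\<in>A. f a x) = (\<lambda>x. \<Sum>a\<in>A. gen_times n i (f a) x)"
  by (induction A rule: infinite_finite_induct) (simp_all add: gen_times_zero gen_times_add)

text \<open>The cells with \<open>a = k\<close> form a chain whose first \<open>b - k + 1\<close> members make up a projective space of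
  dimension \<open>b - k\<close>. The upper bound is exclusive, so this space is \<open>column_sum n k (Suc b)\<close> and the
  empty case \<open>b = k\<close> serves as start of the recursion.\<close>

definition column_sum :: "nat \<Rightarrow> nat \<Rightarrow> nat \<Rightarrow> hecke_elem" where
  "column_sum n k b = (\<lambda>x. \<Sum>b'\<in>{k..<b}. cell_sum n k (exchange k k b') x)"

text \<open>The generator \<open>b\<close> moves the last cell one step further and fixes all cells before it, which
  are thereby counted \<open>1 + q\<close> times instead of once.\<close>

lemma column_sum_step:
  assumes k: "1 \<le> k" and b: "k \<le> b" "b < n"
  shows "column_sum n k (Suc b) x + gen_times n b (column_sum n k (Suc b)) x =
    column_sum n k (Suc (Suc b)) x + hecke_q * column_sum n k b x"
proof -
  have i: "b \<in> {1..<n}" using assms by auto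
  have fixed: "gen_times n b (cell_sum n k (exchange k k b')) = (\<lambda>x. hecke_q * cell_sum n k (exchange k k b') x)"
    if "b' \<in> {k..<b}" for b'
    by (rule cell_sum_fixed[OF i]) (use that b in \<open>auto simp: exchange_def\<close>)
  have "gen_times n b (cell_sum n k (exchange k k b)) =
      cell_sum n k (insert (Suc b) (exchange k k b - {b}))"
    by (rule cell_sum_moved[OF i]) (use b in \<open>auto simp: exchange_def\<close>)
  also have "insert (Suc b) (exchange k k b - {b}) = exchange k k (Suc b)"
    using b by (auto simp: exchange_def)
  finally show ?thesis
    using b by (simp add: column_sum_def gen_times_sum gen_times_add fixed sum_distrib_left)
qed

text \<open>Solve \<open>column_sum_step\<close> for its newest member. The recursion has order two, hence two consecutive
  members in the statement.\<close>

lemma self_dual_column_sum: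
  assumes k: "1 \<le> k" and N: "self_dual n N (cell_sum n k {1..k})" and b: "k \<le> b" "b \<le> n"
  shows "self_dual n (N + int b - int k) (column_sum n k (Suc b)) \<and>
    self_dual n (N + int b - int k - 1) (column_sum n k b)"
  using b
proof (induction b rule: dec_induct)
  case base
  then show ?case
    using N self_dual_zero by (simp add: column_sum_def exchange_self[OF k])
next
  case (step b)
  have IH: "self_dual n (N + int b - int k) (column_sum n k (Suc b))"
      "self_dual n (N + int b - int k - 1) (column_sum n k b)"
    using step by auto
  have eq: "column_sum n k (Suc (Suc b)) =
      (\<lambda>x. (column_sum n k (Suc b) x + gen_times n b (column_sum n k (Suc b)) x) - hecke_q * column_sum n k b x)"
    using column_sum_step[OF k step(1), of n] step by (auto simp: fun_eq_iff)
  \<comment> \<open>The exponents match: one more for \<open>T\<^sub>s + 1\<close>, and two more for \<open>q\<close> times the space two steps back.\<close>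
  have "self_dual n (N + int b - int k + 1) (column_sum n k (Suc (Suc b)))"
    unfolding eq
    by (rule self_dual_diff, rule self_dual_gen_times[OF IH(1)])
       (use step k self_dual_q_scale[OF IH(2)] in \<open>auto simp: algebra_simps\<close>)
  then show ?case
    using IH(1) by (simp add: algebra_simps)
qed

definition row_sum :: "nat \<Rightarrow> nat \<Rightarrow> nat \<Rightarrow> hecke_elem" where
  "row_sum n k a = (\<lambda>x. \<Sum>b\<in>{k<..n}. cell_sum n k (exchange k a b) x)"

text \<open>The Schubert variety of all exchanges with removed element at least \<open>a\<close>. The factor of the identity
  cell, \<open>[k - a + 1]\<close>, is the Poincare polynomial of the fibre of a resolution of singularities.\<close>

definition rows_sum :: "nat \<Rightarrow> nat \<Rightarrow> nat \<Rightarrow> hecke_elem" where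
  "rows_sum n k a =
     (\<lambda>x. (\<Sum>a'\<in>{a..k}. row_sum n k a' x) + q_int (Suc k - a) * cell_sum n k {1..k} x)"

text \<open>The generator \<open>a\<close> moves the row of \<open>a + 1\<close> onto the row of \<open>a\<close> and fixes all the other cells involved,
  so the same two-step recursion as for columns applies. On the identity cell it becomes the recurrence
  of quantum integers.\<close>

lemma rows_sum_step:
  assumes a: "1 \<le> a" "a < k" and k: "k \<le> n"
  shows "rows_sum n k (Suc a) x + gen_times n a (rows_sum n k (Suc a)) x =
    rows_sum n k a x + hecke_q * rows_sum n k (Suc (Suc a)) x"
proof -
  have i: "a \<in> {1..<n}" using assms by auto
  have fixed: "gen_times n a (row_sum n k a') = (\<lambda>x. hecke_q * row_sum n k a' x)"
    if "a' \<in> {Suc (Suc a)..k}" for a'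
  proof -
    have "gen_times n a (cell_sum n k (exchange k a' b)) = (\<lambda>x. hecke_q * cell_sum n k (exchange k a' b) x)" for b
      by (rule cell_sum_fixed[OF i]) (use that a in \<open>auto simp: exchange_def\<close>)
    then show ?thesis
      by (simp add: row_sum_def gen_times_sum sum_distrib_left)
  qed
  have moved: "gen_times n a (row_sum n k (Suc a)) = row_sum n k a"
  proof -
    have "gen_times n a (cell_sum n k (exchange k (Suc a) b)) = cell_sum n k (exchange k a b)"
      if b: "b \<in> {k<..n}" for b
    proof -
      have "gen_times n a (cell_sum n k (exchange k (Suc a) b)) =
          cell_sum n k (insert (Suc a) (exchange k (Suc a) b - {a}))"
        by (rule cell_sum_moved[OF i k]) (use a b in \<open>auto simp: exchange_def\<close>)
      also have "insert (Suc a) (exchange k (Suc a) b - {a}) = exchange k a b"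
        using a b by (auto simp: exchange_def)
      finally show ?thesis .
    qed
    then show ?thesis
      by (simp add: row_sum_def gen_times_sum)
  qed
  have base: "gen_times n a (cell_sum n k {1..k}) = (\<lambda>x. hecke_q * cell_sum n k {1..k} x)"
    by (rule cell_sum_fixed[OF i]) (use a in auto)
  have k_eq: "Suc k - a = Suc (Suc (k - Suc a))" "Suc k - Suc a = Suc (k - Suc a)"
      "Suc k - Suc (Suc a) = k - Suc a"
    using a by auto
  let ?S = "\<Sum>a'\<in>{Suc (Suc a)..k}. row_sum n k a' x" and ?e = "cell_sum n k {1..k} x"
  let ?j = "k - Suc a"
  have split: "(\<Sum>a'\<in>{Suc a..k}. f a') = f (Suc a) + (\<Sum>a'\<in>{Suc (Suc a)..k}. f a')"
      "(\<Sum>a'\<in>{a..k}. f a') = f a + (f (Suc a) + (\<Sum>a'\<in>{Suc (Suc a)..k}. f a'))" for f :: "nat \<Rightarrow> laurent"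
    using a by (simp_all add: sum.atLeast_Suc_atMost)
  have "gen_times n a (rows_sum n k (Suc a)) x =
      row_sum n k a x + hecke_q * ?S + q_int (Suc ?j) * (hecke_q * ?e)"
    unfolding rows_sum_def k_eq
    by (simp add: gen_times_add gen_times_sum gen_times_scale base split moved fixed sum_distrib_left)
  then have "rows_sum n k (Suc a) x + gen_times n a (rows_sum n k (Suc a)) x =
      row_sum n k a x + row_sum n k (Suc a) x + (1 + hecke_q) * ?S + ((1 + hecke_q) * q_int (Suc ?j)) * ?e"
    unfolding rows_sum_def k_eq split by (simp add: algebra_simps)
  also have "\<dots> = rows_sum n k a x + hecke_q * rows_sum n k (Suc (Suc a)) x"
    unfolding q_int_recurrence rows_sum_def k_eq split by (simp add: algebra_simps)
  finally show ?thesis .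
qed

lemma self_dual_rows_sum:
  assumes k: "1 \<le> k" "k \<le> n" and N: "self_dual n N (cell_sum n k {1..k})" and a: "1 \<le> a" "a \<le> k"
  shows "self_dual n (N + int n - int a) (rows_sum n k a) \<and>
    self_dual n (N + int n - int a - 1) (rows_sum n k (Suc a))"
  using a(2,1)
proof (induction a rule: inc_induct)
  case base
  have "{k..<Suc n} = insert k {k<..n}" using k by auto
  then have "rows_sum n k k = column_sum n k (Suc n)"
    using k by (auto simp: rows_sum_def column_sum_def row_sum_def fun_eq_iff exchange_self q_int_Suc)
  moreover have "rows_sum n k (Suc k) = (\<lambda>_. 0)"
    by (simp add: rows_sum_def)
  ultimately show ?case
    using self_dual_column_sum[OF k(1) N k(2)] self_dual_zero by simp
next
  case (step a)
  have IH: "self_dual n (N + int n - int a - 1) (rows_sum n k (Suc a))"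
      "self_dual n (N + int n - int a - 2) (rows_sum n k (Suc (Suc a)))"
    using step by (auto simp: algebra_simps)
  have eq: "rows_sum n k a =
      (\<lambda>x. (rows_sum n k (Suc a) x + gen_times n a (rows_sum n k (Suc a)) x) - hecke_q * rows_sum n k (Suc (Suc a)) x)"
    using rows_sum_step[of a k n] step k by (auto simp: fun_eq_iff)
  have i: "a \<in> {1..<n}" using step k by auto
  have "self_dual n (N + int n - int a) (rows_sum n k a)"
    unfolding eq
    using self_dual_diff[OF self_dual_gen_times[OF IH(1) i], of "\<lambda>x. hecke_q * rows_sum n k (Suc (Suc a)) x"]
      self_dual_q_scale[OF IH(2)] by simp
  then show ?case using IH(1) by simp
qed

text \<open>The recursion over rows ends with the factor \<open>[k]\<close> at the identity cell. If \<open>k \<le> n - k\<close>, this is the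
  smaller of the two possible fibres. Otherwise, with \<open>m = n - k\<close>, write \<open>[k] = [m] + q\<^sup>m [k - m]\<close>: the second
  summand is palindromic about the right exponent, so it can be subtracted without losing self-duality.\<close>

lemma self_dual_schubert_sum:
  assumes k: "1 \<le> k" "k \<le> n" and N: "self_dual n N (cell_sum n k {1..k})"
  shows "self_dual n (N + int n - 1)
    (\<lambda>x. (\<Sum>a\<in>{1..k}. row_sum n k a x) + q_int (min k (n - k)) * cell_sum n k {1..k} x)"
proof -
  have rows: "self_dual n (N + int n - 1)
      (\<lambda>x. (\<Sum>a\<in>{1..k}. row_sum n k a x) + q_int k * cell_sum n k {1..k} x)"
    using self_dual_rows_sum[OF k N, of 1] k by (simp add: rows_sum_def)
  show ?thesis
  proof (cases "k \<le> n - k")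
    case True
    then show ?thesis using rows by (simp add: min_def)
  next
    case False
    \<comment> \<open>Here \<open>k - m = Suc j\<close> is positive, so \<open>[k - m]\<close> is palindromic about \<open>q\<^sup>j\<^sup>/\<^sup>2\<close>.\<close>
    define m j where "m = n - k" and "j = k - m - 1"
    have kmj: "k = m + Suc j" and n: "int n = int k + int m"
      using False k by (auto simp: m_def j_def)
    let ?c = "hecke_q ^ m * q_int (Suc j)"
    have "laurent_bar ?c = laurent_bar (hecke_q ^ m) * laurent_bar (q_int (Suc j))"
      by (rule laurent_bar_mult)
    also have "\<dots> = (qhalf_power (- 2 * int m) * qhalf_power (- 2 * int j)) * q_int (Suc j)"
      unfolding laurent_bar_q_int by (simp add: hecke_q_power laurent_bar_qhalf_power mult.assoc)
    also have "\<dots> = qhalf_power (- 2 * (int n - 1)) * ?c"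
      unfolding hecke_q_power mult.assoc[symmetric] qhalf_power_mult
      by (intro arg_cong2[where f = "(*)"] arg_cong[where f = qhalf_power] refl) (simp add: n kmj)
    finally have "self_dual n (N + (int n - 1)) (\<lambda>x. ?c * cell_sum n k {1..k} x)"
      by (rule self_dual_scale[OF N])
    then have "self_dual n (N + int n - 1) (\<lambda>x. ((\<Sum>a\<in>{1..k}. row_sum n k a x) +
        q_int k * cell_sum n k {1..k} x) - ?c * cell_sum n k {1..k} x)"
      using self_dual_diff[OF rows, of "\<lambda>x. ?c * cell_sum n k {1..k} x"] by (simp add: algebra_simps)
    moreover have "q_int k = q_int m + ?c"
      unfolding kmj by (rule q_int_add)
    moreover have "min k (n - k) = m"
      using False by (simp add: m_def)
    ultimately show ?thesis
      by (simp add: algebra_simps)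
  qed
qed

text \<open>Different exchanges give different subsets, so at most one summand is nonzero.\<close>

lemma row_sums_eq:
  assumes "x permutes {1..n}"
  shows "(\<Sum>a\<in>{1..k}. row_sum n k a x) =
    (if \<exists>a\<in>{1..k}. \<exists>b\<in>{k<..n}. x ` {1..k} = exchange k a b then 1 else 0)"
proof (cases "\<exists>a\<in>{1..k}. \<exists>b\<in>{k<..n}. x ` {1..k} = exchange k a b")
  case True
  then obtain a b where ab: "a \<in> {1..k}" "b \<in> {k<..n}" "x ` {1..k} = exchange k a b" by blast
  have eq: "exchange k a b = exchange k a' b' \<longleftrightarrow> a' = a \<and> b' = b" if "a' \<in> {1..k}" "b' \<in> {k<..n}" for a' b'
  proof
    assume eq: "exchange k a b = exchange k a' b'"
    have "b \<in> exchange k a b" "a' \<notin> exchange k a' b'"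
      using that by (auto simp: exchange_def)
    then have "b \<in> exchange k a' b'" "a' \<notin> exchange k a b" using eq by simp_all
    then show "a' = a \<and> b' = b"
      using that ab by (auto simp: exchange_def)
  qed auto
  have "(\<Sum>a\<in>{1..k}. row_sum n k a x) = (\<Sum>a'\<in>{1..k}. if a' = a then 1 else 0)"
  proof (rule sum.cong)
    fix a' assume a': "a' \<in> {1..k}"
    have "row_sum n k a' x = (\<Sum>b'\<in>{k<..n}. if b' = b then (if a' = a then 1 else 0) else 0)"
      unfolding row_sum_def
      by (rule sum.cong) (use assms ab a' eq in \<open>auto simp: cell_sum_def\<close>)
    then show "row_sum n k a' x = (if a' = a then 1 else 0)"
      using ab by (simp add: sum.delta)
  qed simp
  then show ?thesis
    using ab True by (simp add: sum.delta)
next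
  case False
  then show ?thesis
    by (auto simp: row_sum_def cell_sum_def intro!: sum.neutral)
qed

section \<open>One-line notation and lengths of \<open>x\<close> and \<open>w\<close>\<close>

lemma length_run_down: "length (run_down a b) = Suc a - b"
  by (simp add: run_down_def del: upt_Suc)

lemma nth_run_down:
  assumes "i < Suc a - b"
  shows "run_down a b ! i = a - i"
proof -
  have "run_down a b ! i = [b..<Suc a] ! (Suc a - b - Suc i)"
    unfolding run_down_def using assms by (subst rev_nth) (simp_all del: upt_Suc)
  also have "\<dots> = b + (Suc a - b - Suc i)"
    using assms by (intro nth_upt) simp
  finally show ?thesis using assms by simp
qed

lemma x_perm_low: "1 \<le> i \<Longrightarrow> i \<le> k \<Longrightarrow> x_perm k m i = Suc k - i"
  and x_perm_high: "k < i \<Longrightarrow> i \<le> k + m \<Longrightarrow> x_perm k m i = Suc (2 * k + m) - i"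
  and x_perm_outside: "i \<notin> {1..k + m} \<Longrightarrow> x_perm k m i = i"
  by (auto simp: x_perm_def one_line_def length_run_down nth_append nth_run_down)

context
  fixes k m :: nat
  assumes km: "2 \<le> k" "2 \<le> m"
begin

lemma w_perm_first: "w_perm k m 1 = k + m"
  and w_perm_last: "w_perm k m (k + m) = 1"
  and w_perm_outside: "i \<notin> {1..k + m} \<Longrightarrow> w_perm k m i = i"
  using km by (auto simp: w_perm_def one_line_def length_run_down nth_append nth_Cons')

lemma w_perm_low:
  assumes "2 \<le> i" "i \<le> k"
  shows "w_perm k m i = Suc (Suc k) - i"
proof -
  have "run_down k 2 ! (i - 2) = k - (i - 2)"
    using assms by (intro nth_run_down) simp
  moreover have "i - Suc 1 = i - 2" by simp
  ultimately show ?thesis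
    using km assms by (simp add: w_perm_def one_line_def length_run_down nth_append)
qed

lemma w_perm_high:
  assumes "k < i" "i < k + m"
  shows "w_perm k m i = 2 * k + m - i"
proof -
  let ?L = "(k + m) # run_down k 2" and ?R = "run_down (k + m - 1) (k + 1)"
  have len: "length ?L = k" "length ?R = m - 1"
    using km by (simp_all add: length_run_down)
  have "w_perm k m i = (?L @ ?R @ [1]) ! (i - 1)"
    using km assms by (simp add: w_perm_def one_line_def length_run_down)
  also have "\<dots> = ?R ! (i - 1 - k)"
  proof -
    have "\<not> i - 1 < k" "i - 1 - k < m - 1" using assms km by auto
    then show ?thesis unfolding nth_append len by (simp only: if_True if_False)
  qed
  also have "\<dots> = (k + m - 1) - (i - 1 - k)"
    using assms by (intro nth_run_down) simp
  finally show ?thesis using assms by simp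
qed

end

lemma involution_permutes:
  assumes "\<And>i. f (f i) = i" "\<And>i. i \<notin> S \<Longrightarrow> f i = i"
  shows "f permutes S"
  using assms unfolding permutes_def by metis

lemma x_perm_twice: "x_perm k m (x_perm k m i) = i"
proof -
  consider "1 \<le> i" "i \<le> k" | "k < i" "i \<le> k + m" | "i \<notin> {1..k + m}" by force
  then show ?thesis
  proof cases
    case 1
    then show ?thesis using x_perm_low[of "Suc k - i" k m] by (simp add: x_perm_low)
  next
    case 2
    then show ?thesis using x_perm_high[of k "Suc (2 * k + m) - i" m] by (simp add: x_perm_high)
  qed (simp add: x_perm_outside)
qed

lemma w_perm_twice:
  assumes km: "2 \<le> k" "2 \<le> m"
  shows "w_perm k m (w_perm k m i) = i"
proof -
  consider "i = 1" | "i = k + m" | "2 \<le> i" "i \<le> k" | "k < i" "i < k + m" | "i \<notin> {1..k + m}" by force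
  then show ?thesis
  proof cases
    case 3
    then show ?thesis using w_perm_low[OF km, of "Suc (Suc k) - i"] by (simp add: w_perm_low[OF km])
  next
    case 4
    then show ?thesis using w_perm_high[OF km, of "2 * k + m - i"] by (simp add: w_perm_high[OF km])
  qed (simp_all add: w_perm_first[OF km] w_perm_last[OF km] w_perm_outside[OF km])
qed

lemma x_perm_permutes: "x_perm k m permutes {1..k + m}"
  by (rule involution_permutes) (auto simp: x_perm_twice x_perm_outside)

lemma w_perm_permutes:
  assumes "2 \<le> k" "2 \<le> m"
  shows "w_perm k m permutes {1..k + m}"
  by (rule involution_permutes) (auto simp: w_perm_twice[OF assms] w_perm_outside[OF assms])

lemma x_perm_image: "x_perm k m ` {1..k} = {1..k}"
proof -
  have sub: "x_perm k m ` {1..k} \<subseteq> {1..k}"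
    by (auto simp: x_perm_low)
  moreover have "{1..k} \<subseteq> x_perm k m ` {1..k}"
  proof
    fix i assume "i \<in> {1..k}"
    then have "x_perm k m i \<in> {1..k}" using sub by blast
    then show "i \<in> x_perm k m ` {1..k}"
      using x_perm_twice[of k m i] by (metis image_eqI)
  qed
  ultimately show ?thesis by blast
qed

lemma w_perm_image:
  assumes km: "2 \<le> k" "2 \<le> m"
  shows "w_perm k m ` {1..k} = exchange k 1 (k + m)"
proof -
  have into: "w_perm k m i \<in> {2..k}" if "i \<in> {2..k}" for i
    using that w_perm_low[OF km, of i] unfolding atLeastAtMost_iff by linarith
  have "{2..k} \<subseteq> w_perm k m ` {2..k}"
    using into w_perm_twice[OF km] by (metis image_eqI subsetI)
  then have "w_perm k m ` {2..k} = {2..k}"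
    using into by blast
  moreover have "{1..k} = insert 1 {2..k}" using km by auto
  moreover have "exchange k 1 (k + m) = insert (k + m) {2..k}" by (auto simp: exchange_def)
  ultimately show ?thesis
    by (simp add: w_perm_first[OF km])
qed

lemma x_perm_inversion_iff:
  assumes "1 \<le> i" "i < j" "j \<le> k + m"
  shows "x_perm k m j < x_perm k m i \<longleftrightarrow> j \<le> k \<or> k < i"
proof -
  consider "j \<le> k" | "k < i" | "i \<le> k" "k < j" by linarith
  then show ?thesis
  proof cases
    case 3
    then have "x_perm k m i = Suc k - i" "x_perm k m j = Suc (2 * k + m) - j"
      using assms by (simp_all add: x_perm_low x_perm_high)
    then show ?thesis using 3 assms by linarith
  qed (use assms in \<open>simp_all add: x_perm_low x_perm_high\<close>)
qed

lemma w_perm_inversion_iff: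
  assumes km: "2 \<le> k" "2 \<le> m" and ij: "1 \<le> i" "i < j" "j \<le> k + m"
  shows "w_perm k m j < w_perm k m i \<longleftrightarrow> j \<le> k \<or> k < i \<or> i = 1 \<or> j = k + m"
proof -
  have range: "1 \<le> w_perm k m i \<and> w_perm k m i \<le> k + m" if "1 \<le> i" "i \<le> k + m" for i
    using perm_range[OF w_perm_permutes[OF km], of i] that by simp
  have ne: "w_perm k m i \<noteq> w_perm k m j"
    using ij w_perm_twice[OF km] by (metis less_irrefl)
  consider "i = 1" | "j = k + m" | "2 \<le> i" "j \<le> k" | "k < i" "j < k + m" | "2 \<le> i" "i \<le> k" "k < j" "j < k + m"
    using ij by linarith
  then show ?thesis
  proof cases
    case 1
    then show ?thesis using range[of j] ne w_perm_first[OF km] ij by simp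
  next
    case 2
    then show ?thesis using range[of i] ne w_perm_last[OF km] ij by simp
  next
    case 3
    then have "w_perm k m i = Suc (Suc k) - i" "w_perm k m j = Suc (Suc k) - j"
      using ij by (simp_all add: w_perm_low[OF km])
    then show ?thesis using 3 ij by simp
  next
    case 4
    then have "w_perm k m i = 2 * k + m - i" "w_perm k m j = 2 * k + m - j"
      using ij by (simp_all add: w_perm_high[OF km])
    then show ?thesis using 4 ij by simp
  next
    case 5
    then have "w_perm k m i = Suc (Suc k) - i" "w_perm k m j = 2 * k + m - j"
      using ij by (simp_all add: w_perm_high[OF km] w_perm_low[OF km])
    then show ?thesis using 5 ij by linarith
  qed
qed

lemma inversions_x_perm:
  "inversions (k + m) (x_perm k m) = {(i, j). 1 \<le> i \<and> i < j \<and> j \<le> k + m \<and> (j \<le> k \<or> k < i)}"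
proof -
  have "z \<in> inversions (k + m) (x_perm k m) \<longleftrightarrow>
      z \<in> {(i, j). 1 \<le> i \<and> i < j \<and> j \<le> k + m \<and> (j \<le> k \<or> k < i)}" for z
    using x_perm_inversion_iff[of "fst z" "snd z" k m] by (cases z) (auto simp: inversions_def)
  then show ?thesis by blast
qed

lemma inversions_w_perm:
  assumes "2 \<le> k" "2 \<le> m"
  shows "inversions (k + m) (w_perm k m) =
    {(i, j). 1 \<le> i \<and> i < j \<and> j \<le> k + m \<and> (j \<le> k \<or> k < i \<or> i = 1 \<or> j = k + m)}"
proof -
  have "z \<in> inversions (k + m) (w_perm k m) \<longleftrightarrow>
      z \<in> {(i, j). 1 \<le> i \<and> i < j \<and> j \<le> k + m \<and> (j \<le> k \<or> k < i \<or> i = 1 \<or> j = k + m)}" for z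
    using w_perm_inversion_iff[OF assms, of "fst z" "snd z"] by (cases z) (auto simp: inversions_def)
  then show ?thesis by blast
qed

text \<open>A permutation preserving \<open>{1..k}\<close> has inversions only inside the two blocks, and \<open>x\<close> inverts all
  pairs inside the blocks.\<close>

lemma perm_length_le_x_perm:
  assumes x: "x permutes {1..k + m}" "x ` {1..k} = {1..k}"
  shows "perm_length (k + m) x \<le> perm_length (k + m) (x_perm k m)"
  unfolding perm_length_inversions
proof (rule card_mono)
  have *: "x i < x j" if "1 \<le> i" "i \<le> k" "k < j" "j \<le> k + m" for i j
  proof -
    have "x i \<in> {1..k}" using that x(2) by auto
    moreover have "x j \<notin> {1..k}"
    proof
      assume "x j \<in> {1..k}"
      then have "x j \<in> x ` {1..k}" using x(2) by simp
      then have "j \<in> {1..k}" using permutes_inj[OF x(1)] by (simp add: inj_image_mem_iff)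
      then show False using that by simp
    qed
    moreover have "x j \<in> {1..k + m}"
      using that perm_range[OF x(1), of j] by simp
    ultimately show ?thesis by simp
  qed
  show "inversions (k + m) x \<subseteq> inversions (k + m) (x_perm k m)"
  proof
    fix z assume z: "z \<in> inversions (k + m) x"
    have "snd z \<le> k \<or> k < fst z"
    proof (rule ccontr)
      assume "\<not> ?thesis"
      then have "x (fst z) < x (snd z)"
        using z by (intro *) (auto simp: inversions_def)
      then show False using z by (auto simp: inversions_def)
    qed
    then show "z \<in> inversions (k + m) (x_perm k m)"
      using z unfolding inversions_x_perm by (auto simp: inversions_def)
  qed
qed simp

text \<open>Besides the pairs inside a block, \<open>w\<close> inverts those pairs across the blocks that involve the first or
  the last position: there are \<open>m + (k - 1)\<close> of them.\<close>

lemma perm_length_w_perm: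
  assumes "2 \<le> k" "2 \<le> m"
  shows "perm_length (k + m) (w_perm k m) = perm_length (k + m) (x_perm k m) + (k + m - 1)"
proof -
  let ?A = "{1::nat} \<times> {k<..k + m}" and ?B = "{2..k} \<times> {k + m}"
  have "inversions (k + m) (w_perm k m) = inversions (k + m) (x_perm k m) \<union> (?A \<union> ?B)"
    unfolding inversions_x_perm inversions_w_perm[OF assms] using assms by auto
  moreover have "inversions (k + m) (x_perm k m) \<inter> (?A \<union> ?B) = {}" "?A \<inter> ?B = {}"
    using assms by (auto simp: inversions_x_perm)
  ultimately have "perm_length (k + m) (w_perm k m) =
      perm_length (k + m) (x_perm k m) + (card ?A + card ?B)"
    unfolding perm_length_inversions by (simp add: card_Un_disjoint)
  then show ?thesis using assms by simp
qed

section \<open>The Bruhat order below \<open>w\<close>\<close>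

lemma perm_length_le_square: "perm_length n x \<le> n * n"
proof -
  have "inversions n x \<subseteq> {1..n} \<times> {1..n}"
    by (auto simp: inversions_def)
  from card_mono[OF _ this] show ?thesis
    by (simp add: perm_length_inversions card_cartesian_product)
qed

lemma bruhat_step_right:
  assumes "x permutes {1..n}" "i \<in> {1..<n}" "x i < x (Suc i)"
  shows "bruhat_step n x (x \<circ> adj_transp i)"
  unfolding bruhat_step_def adj_transp_def[symmetric]
  using perm_length_right_ascent[OF assms] assms(2)
  by (intro bexI[of _ i] bexI[of _ "Suc i"]) (auto simp: adj_transp_def)

lemma bruhat_step_left:
  assumes x: "x permutes {1..n}" and i: "i \<in> {1..<n}" and asc: "left_ascent i x"
  shows "bruhat_step n x (adj_transp i \<circ> x)"
proof -
  let ?p = "Hilbert_Choice.inv x i" and ?q = "Hilbert_Choice.inv x (Suc i)"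
  have "adj_transp i \<circ> x = x \<circ> transpose ?p ?q"
    unfolding adj_transp_def by (rule transpose_comp_eq[OF permutes_bij[OF x]])
  moreover have "?p \<in> {1..n}" "?q \<in> {1..n}"
    using i perm_range[OF permutes_inv[OF x]] by simp_all
  ultimately show ?thesis
    unfolding bruhat_step_def using perm_length_left_ascent[OF assms] asc
    by (intro bexI[of _ ?p] bexI[of _ ?q]) simp_all
qed

lemma decreasing_run:
  fixes f :: "nat \<Rightarrow> nat"
  assumes "\<And>i. l \<le> i \<Longrightarrow> i < u \<Longrightarrow> f (Suc i) < f i" and "l \<le> i" "i < j" "j \<le> u"
  shows "f j < f i"
  using assms(3,4)
proof (induction j)
  case (Suc j)
  then show ?case
    using assms(1)[of j] assms(2) by (cases "i = j") auto
qed simp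

text \<open>Being decreasing on both blocks of positions, \<open>x\<close> has the exceptional large value \<open>b\<close> first and the
  exceptional small value \<open>a\<close> last. Since the inverse is decreasing on both blocks of values as well, \<open>b\<close>
  is the largest and \<open>a\<close> the smallest value. Now all the values are forced; formally, the composition of
  \<open>x\<close> with the involution \<open>w\<close> has no descent.\<close>

lemma w_perm_unique_maximal:
  assumes km: "2 \<le> k" "2 \<le> m" and x: "x permutes {1..k + m}"
    and img: "x ` {1..k} = exchange k a b" and a: "a \<in> {1..k}" and b: "b \<in> {k<..k + m}"
    and R: "\<And>i. i \<in> {1..<k + m} \<Longrightarrow> i \<noteq> k \<Longrightarrow> x (Suc i) < x i"
    and L: "\<And>i. i \<in> {1..<k + m} \<Longrightarrow> i \<noteq> k \<Longrightarrow> Hilbert_Choice.inv x (Suc i) < Hilbert_Choice.inv x i"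
  shows "x = w_perm k m"
proof -
  let ?n = "k + m" and ?y = "Hilbert_Choice.inv x" and ?w = "w_perm k m"
  have y: "?y permutes {1..?n}" and xy: "x (?y i) = i" "?y (x i) = i" for i
    using x by (simp_all add: permutes_inv permutes_inverses)
  have inj: "x i = x j \<longleftrightarrow> i = j" for i j
    using permutes_inj[OF x] by (simp add: inj_eq)
  have range: "1 \<le> x i \<and> x i \<le> ?n" "1 \<le> ?y i \<and> ?y i \<le> ?n" if "1 \<le> i" "i \<le> ?n" for i
    using perm_range[OF x, of i] perm_range[OF y, of i] that by simp_all
  have mem: "x i \<in> exchange k a b \<longleftrightarrow> i \<in> {1..k}" for i
    unfolding img[symmetric] using permutes_inj[OF x] by (rule inj_image_mem_iff)
  have dec: "x j < x i" "?y j < ?y i"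
    if "1 \<le> i \<and> j \<le> k \<or> k < i \<and> j \<le> ?n" "i < j" for i j
  proof -
    have "x j < x i \<and> ?y j < ?y i"
    proof (cases "j \<le> k")
      case True
      have "x j < x i" by (rule decreasing_run[where l = 1 and u = k]) (use R that True km in auto)
      moreover have "?y j < ?y i" by (rule decreasing_run[where l = 1 and u = k]) (use L that True km in auto)
      ultimately show ?thesis ..
    next
      case False
      have "x j < x i" by (rule decreasing_run[where l = "Suc k" and u = ?n]) (use R that False km in auto)
      moreover have "?y j < ?y i" by (rule decreasing_run[where l = "Suc k" and u = ?n]) (use L that False km in auto)
      ultimately show ?thesis ..
    qed
    then show "x j < x i" "?y j < ?y i" by auto
  qed
  have x1: "x 1 = b"
  proof (rule ccontr)
    assume ne: "x 1 \<noteq> b"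
    have "x (?y b) \<in> exchange k a b" by (simp add: xy exchange_def)
    then have "?y b \<in> {1..k}" by (simp only: mem)
    moreover have "?y b \<noteq> 1" using ne xy by metis
    ultimately have "x (?y b) < x 1" by (intro dec) auto
    moreover have "x 1 \<in> exchange k a b" using mem km by simp
    ultimately show False using ne b by (auto simp: exchange_def xy)
  qed
  have xn: "x ?n = a"
  proof (rule ccontr)
    assume ne: "x ?n \<noteq> a"
    have "x (?y a) \<notin> exchange k a b" using a b by (simp add: xy exchange_def)
    then have "?y a \<notin> {1..k}" using mem[of "?y a"] by blast
    moreover have "?y a \<noteq> ?n" using ne xy by metis
    moreover have "1 \<le> ?y a \<and> ?y a \<le> ?n" using range a by simp
    ultimately have "x ?n < x (?y a)" by (intro dec) auto
    moreover have "x ?n \<notin> exchange k a b" using mem[of ?n] km by simp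
    moreover have "1 \<le> x ?n" using range km by simp
    ultimately show False using ne a by (auto simp: exchange_def xy)
  qed
  have a1: "a = 1"
  proof (rule ccontr)
    assume "a \<noteq> 1"
    then have "?y a < ?y 1" using a by (intro dec) auto
    moreover have "?y a = ?n" using xn xy by metis
    moreover have "?y 1 \<le> ?n" using range[of 1] km by simp
    ultimately show False by simp
  qed
  have bn: "b = ?n"
  proof (rule ccontr)
    assume "b \<noteq> ?n"
    then have "?y ?n < ?y b" using b by (intro dec) auto
    moreover have "?y b = 1" using x1 xy by metis
    moreover have "1 \<le> ?y ?n" using range[of ?n] km by simp
    ultimately show False by simp
  qed
  have low: "x i \<le> k" if "2 \<le> i" "i \<le> k" for i
    using mem[of i] inj[of i 1] that x1 by (auto simp: exchange_def)
  have high: "k < x i" if "k < i" "i < ?n" for i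
    using mem[of i] inj[of i ?n] range[of i] that xn a1 by (auto simp: exchange_def)
  \<comment> \<open>The five cases are the positions around and inside the two decreasing middle runs of \<open>w\<close>.\<close>
  have "(x \<circ> ?w) i < (x \<circ> ?w) (Suc i)" if i: "i \<in> {1..<?n}" for i
  proof -
    consider "i = 1" | "2 \<le> i" "i < k" | "i = k" | "k < i" "Suc i < ?n" | "k < i" "Suc i = ?n"
      using i by force
    then show ?thesis
    proof cases
      case 1
      have "?w 1 = ?n" "?w (Suc 1) = k" using km w_perm_first[OF km] w_perm_low[OF km, of "Suc 1"] by simp_all
      moreover have "x ?n < x k"
        using inj[of k ?n] range[of k] xn a1 km by auto
      ultimately show ?thesis using 1 by simp
    next
      case 2
      then have "?w i = Suc (Suc k) - i" "?w (Suc i) = Suc k - i" using km by (simp_all add: w_perm_low)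
      moreover have "x (Suc (Suc k) - i) < x (Suc k - i)" using 2 by (intro dec) auto
      ultimately show ?thesis by simp
    next
      case 3
      then have "?w i = 2" "?w (Suc i) = ?n - 1" using km by (simp_all add: w_perm_low w_perm_high)
      moreover have "x 2 \<le> k" "k < x (?n - 1)" using low high km by simp_all
      ultimately show ?thesis by simp
    next
      case 4
      then have "?w i = 2 * k + m - i" "?w (Suc i) = 2 * k + m - Suc i" using km by (simp_all add: w_perm_high)
      moreover have "x (2 * k + m - i) < x (2 * k + m - Suc i)" using 4 by (intro dec) auto
      ultimately show ?thesis by simp
    next
      case 5
      then have "?w i = Suc k" "?w (Suc i) = 1" using km w_perm_high[OF km, of i] w_perm_last[OF km] by auto
      moreover have "x (Suc k) < x 1"
        using inj[of "Suc k" 1] range[of "Suc k"] x1 bn km by auto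
      ultimately show ?thesis by simp
    qed
  qed
  then have "x \<circ> ?w = id"
    using perm_without_descent_is_id[OF permutes_compose[OF w_perm_permutes[OF km] x]] by blast
  then have "x i = ?w i" for i
    using w_perm_twice[OF km, of i] by (metis comp_apply id_apply)
  then show ?thesis by blast
qed

text \<open>The union of the two double cosets of the parabolic subgroup that contain \<open>x\<close> and \<open>w\<close>.\<close>

definition at_most_one_exchange :: "nat \<Rightarrow> nat \<Rightarrow> perm \<Rightarrow> bool" where
  "at_most_one_exchange n k x \<longleftrightarrow> x permutes {1..n} \<and>
     (x ` {1..k} = {1..k} \<or> (\<exists>a\<in>{1..k}. \<exists>b\<in>{k<..n}. x ` {1..k} = exchange k a b))"

lemma right_mult_image:
  assumes "i \<noteq> k" "1 \<le> i"
  shows "(x \<circ> adj_transp i) ` {1..k} = x ` {1..k}"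
proof -
  have "adj_transp i ` {1..k} = {1..k}"
    using assms by (intro adj_transp_image_fixed) auto
  then show ?thesis unfolding image_comp[symmetric] by simp
qed

text \<open>In the unit coset the generator \<open>k\<close> is a right ascent that leads to the other double coset. That double
  coset is preserved by all other generators on both sides, and by \<open>w_perm_unique_maximal\<close> only \<open>w\<close> has
  no ascent among them.\<close>

lemma at_most_one_exchange_ascend:
  assumes km: "2 \<le> k" "2 \<le> m" and near: "at_most_one_exchange (k + m) k x" and ne: "x \<noteq> w_perm k m"
  shows "\<exists>y. bruhat_step (k + m) x y \<and> at_most_one_exchange (k + m) k y"
proof -
  let ?n = "k + m"
  have x: "x permutes {1..?n}" using near by (simp add: at_most_one_exchange_def)
  consider "x ` {1..k} = {1..k}"
    | a b where "a \<in> {1..k}" "b \<in> {k<..?n}" "x ` {1..k} = exchange k a b"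
    using near unfolding at_most_one_exchange_def by blast
  then show ?thesis
  proof cases
    case 1
    have i: "k \<in> {1..<?n}" using km by simp
    have inj: "inj x" using permutes_inj[OF x] .
    have xk: "x k \<in> {1..k}" using 1 km by auto
    have "x (Suc k) \<notin> x ` {1..k}" using inj_image_mem_iff[OF inj, of "Suc k" "{1..k}"] by simp
    then have "x (Suc k) \<notin> {1..k}" using 1 by simp
    moreover have "x (Suc k) \<in> {1..?n}" using perm_range[OF x, of "Suc k"] km by simp
    ultimately have xSk: "x (Suc k) \<in> {k<..?n}" by auto
    have "adj_transp k ` {1..k} = insert (Suc k) ({1..k} - {k})"
      by (rule adj_transp_image_moved) (use km in auto)
    then have "(x \<circ> adj_transp k) ` {1..k} = insert (x (Suc k)) (x ` {1..k} - x ` {k})"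
      unfolding image_comp[symmetric] by (simp add: image_set_diff[OF inj])
    then have "(x \<circ> adj_transp k) ` {1..k} = exchange k (x k) (x (Suc k))"
      unfolding 1 by (simp add: exchange_def)
    then have "at_most_one_exchange ?n k (x \<circ> adj_transp k)"
      unfolding at_most_one_exchange_def right_mult_permutes[OF i] using x xk xSk by blast
    moreover have "bruhat_step ?n x (x \<circ> adj_transp k)"
      using bruhat_step_right[OF x i] xk xSk by simp
    ultimately show ?thesis by blast
  next
    case 2
    show ?thesis
    proof (rule ccontr)
      assume none: "\<not> ?thesis"
      have R: "x (Suc i) < x i" if i: "i \<in> {1..<?n}" "i \<noteq> k" for i
      proof (rule ccontr)
        assume "\<not> x (Suc i) < x i"
        moreover have "x i \<noteq> x (Suc i)"
          using permutes_inj[OF x] by (simp add: inj_eq)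
        ultimately have "bruhat_step ?n x (x \<circ> adj_transp i)"
          using bruhat_step_right[OF x i(1)] by simp
        moreover have "at_most_one_exchange ?n k (x \<circ> adj_transp i)"
          using near i unfolding at_most_one_exchange_def right_mult_permutes[OF i(1)]
          by (subst right_mult_image, simp, simp)+
        ultimately show False using none by blast
      qed
      have L: "Hilbert_Choice.inv x (Suc i) < Hilbert_Choice.inv x i" if i: "i \<in> {1..<?n}" "i \<noteq> k" for i
      proof (rule ccontr)
        assume "\<not> Hilbert_Choice.inv x (Suc i) < Hilbert_Choice.inv x i"
        then have "bruhat_step ?n x (adj_transp i \<circ> x)"
          using bruhat_step_left[OF x i(1)] inv_neq_Suc[OF x, of i] by simp
        moreover have "adj_transp i ` exchange k a b = exchange k (adj_transp i a) (adj_transp i b)"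
        proof -
          have inj: "inj (adj_transp i)" by (metis injI adj_transp_twice(1))
          have "adj_transp i ` {1..k} = {1..k}"
            using i by (intro adj_transp_image_fixed) auto
          then show ?thesis
            by (simp add: exchange_def image_set_diff[OF inj])
        qed
        then have "(adj_transp i \<circ> x) ` {1..k} = exchange k (adj_transp i a) (adj_transp i b)"
          using 2 unfolding image_comp[symmetric] by simp
        moreover have "adj_transp i a \<in> {1..k}" "adj_transp i b \<in> {k<..?n}"
          using 2 i by (auto simp: adj_transp_def transpose_def)
        ultimately show False
          using none x left_mult_permutes[OF i(1), of x] unfolding at_most_one_exchange_def by blast
      qed
      show False
        using w_perm_unique_maximal[OF km x 2(3,1,2) R L] ne by blast
    qed
  qed
qed

lemma at_most_one_exchange_bruhat_le:
  assumes km: "2 \<le> k" "2 \<le> m" and "at_most_one_exchange (k + m) k x"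
  shows "bruhat_le (k + m) x (w_perm k m)"
proof -
  let ?n = "k + m"
  have "(bruhat_step ?n)\<^sup>*\<^sup>* x (w_perm k m)"
    using assms(3)
  proof (induction "?n * ?n - perm_length ?n x" arbitrary: x rule: less_induct)
    case less
    show ?case
    proof (cases "x = w_perm k m")
      case False
      then obtain y where y: "bruhat_step ?n x y" "at_most_one_exchange ?n k y"
        using at_most_one_exchange_ascend[OF km less.prems] by blast
      have "perm_length ?n x < perm_length ?n y"
        using y(1) by (auto simp: bruhat_step_def)
      then have "?n * ?n - perm_length ?n y < ?n * ?n - perm_length ?n x"
        using perm_length_le_square[of ?n y] by linarith
      then show ?thesis
        using less.hyps[OF _ y(2)] y(1) by (meson converse_rtranclp_into_rtranclp)
    qed simp
  qed
  then show ?thesis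
    using assms(3) w_perm_permutes[OF km] by (simp add: bruhat_le_def carrier_sym_group at_most_one_exchange_def)
qed

lemma bruhat_less_perm_length:
  assumes "bruhat_le n x y" "x \<noteq> y"
  shows "perm_length n x < perm_length n y"
proof -
  have "(bruhat_step n)\<^sup>*\<^sup>* x y" using assms by (simp add: bruhat_le_def)
  then have "x = y \<or> perm_length n x < perm_length n y"
    by (induction rule: rtranclp_induct) (auto simp: bruhat_step_def)
  then show ?thesis using assms by simp
qed

lemma sum_monom_degree: "degree (\<Sum>i<j. monom (1::int) i) \<le> j - 1"
  by (rule degree_sum_le) (auto intro!: order.trans[OF degree_monom_le])

section \<open>The Kazhdan--Lusztig family\<close>

text \<open>The family belonging to the self-dual element of the preceding sections: \<open>[min k m]\<close> on the unit
  coset and \<open>1\<close> on the double coset of \<open>w\<close>. The degree bound is tightest on \<open>x\<close>, where it reads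
  \<open>2 (min k m - 1) + 1 \<le> k + m - 1\<close>.\<close>

lemma is_KL_family_w_perm:
  assumes km: "2 \<le> k" "2 \<le> m"
  shows "is_KL_family (k + m) (w_perm k m) (\<lambda>x.
    if \<not> at_most_one_exchange (k + m) k x then 0
    else if x ` {1..k} = {1..k} then \<Sum>i<min k m. monom 1 i else 1)"
    (is "is_KL_family ?n ?w ?P")
proof -
  define Q where "Q = ?P"
  let ?lx = "perm_length ?n (x_perm k m)" and ?lw = "perm_length ?n ?w"
  let ?M = "\<lambda>x. (\<Sum>a\<in>{1..k}. row_sum ?n k a x) + q_int (min k (?n - k)) * cell_sum ?n k {1..k} x"
  have ex_ne: "exchange k a b \<noteq> {1..k}" if "b \<in> {k<..?n}" for a b
    using that unfolding exchange_def by (metis atLeastAtMost_iff greaterThanAtMost_iff insertI1 not_le)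
  have M_eq: "?M x = poly_in_q (Q x)" for x
  proof (cases "at_most_one_exchange ?n k x")
    case True
    then have x: "x permutes {1..?n}" by (simp add: at_most_one_exchange_def)
    show ?thesis
    proof (cases "x ` {1..k} = {1..k}")
      case img: True
      then have "\<not> (\<exists>a\<in>{1..k}. \<exists>b\<in>{k<..?n}. x ` {1..k} = exchange k a b)"
        using ex_ne by metis
      then show ?thesis
        using True x img by (simp add: row_sums_eq Q_def poly_in_q_geometric cell_sum_def)
    next
      case False
      then show ?thesis
        using True x by (simp add: row_sums_eq Q_def cell_sum_def at_most_one_exchange_def)
    qed
  next
    case False
    then have "?M x = 0"
      by (cases "x permutes {1..?n}")
         (auto simp: at_most_one_exchange_def row_sums_eq cell_sum_def row_sum_def)
    then show ?thesis using False by (simp add: Q_def)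
  qed
  have "self_dual ?n (int ?lx) (cell_sum ?n k {1..k})"
    using km by (intro self_dual_parabolic x_perm_permutes x_perm_image perm_length_le_x_perm) auto
  then have "self_dual ?n (int ?lx + int ?n - 1) ?M"
    using km by (intro self_dual_schubert_sum) auto
  moreover have "int ?lx + int ?n - 1 = int ?lw"
    using perm_length_w_perm[OF km] km by simp
  ultimately have "self_dual ?n (int ?lw) ?M"
    by (simp only:)
  then have "hecke_bar ?n ?M = (\<lambda>x. qhalf_power (- 2 * int ?lw) * ?M x)"
    unfolding self_dual_def ..
  then have M_bar: "hecke_bar ?n (\<lambda>x. poly_in_q (Q x)) = (\<lambda>x. qhalf_power (- 2 * int ?lw) * poly_in_q (Q x))"
    by (simp only: M_eq)
  have bar: "hecke_bar ?n (KL_elem ?n ?w Q) = KL_elem ?n ?w Q"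
    unfolding KL_elem_def hecke_bar_scale M_bar
    by (simp add: laurent_bar_qhalf_power mult.assoc[symmetric] qhalf_power_mult)
  have w_near: "at_most_one_exchange ?n k ?w"
    using w_perm_permutes[OF km] w_perm_image[OF km] km unfolding at_most_one_exchange_def
    by (intro conjI disjI2 bexI[of _ 1] bexI[of _ "k + m"]) auto
  have w1: "Q ?w = 1"
    using w_near w_perm_image[OF km] ex_ne[of "k + m" 1] km by (simp add: Q_def)
  have supp: "Q x = 0" if "\<not> bruhat_le ?n x ?w" for x
    using at_most_one_exchange_bruhat_le[OF km] that by (auto simp: Q_def)
  have deg: "2 * degree (Q x) + perm_length ?n x + 1 \<le> ?lw" if x: "bruhat_le ?n x ?w" "x \<noteq> ?w" for x
  proof (cases "at_most_one_exchange ?n k x \<and> x ` {1..k} = {1..k}")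
    case True
    then have "degree (Q x) \<le> min k m - 1"
      using sum_monom_degree[of "min k m"] by (simp add: Q_def)
    moreover have "perm_length ?n x \<le> ?lx"
      using True by (intro perm_length_le_x_perm) (auto simp: at_most_one_exchange_def)
    ultimately show ?thesis
      using perm_length_w_perm[OF km] km by linarith
  next
    case False
    then have "degree (Q x) = 0" by (auto simp: Q_def)
    then show ?thesis using bruhat_less_perm_length[OF x] by simp
  qed
  show ?thesis
    unfolding Q_def[symmetric] is_KL_family_def using bar w1 supp deg by blast
qed

theorem theorem53:
  fixes k m :: nat
  assumes "2 \<le> k" and "2 \<le> m"
  shows "KL_poly (k + m) (x_perm k m) (w_perm k m) = (\<Sum>i = 0..min (k - 1) (m - 1). monom 1 i)"
proof -
  have "at_most_one_exchange (k + m) k (x_perm k m)"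
    by (simp add: at_most_one_exchange_def x_perm_permutes x_perm_image)
  then have "KL_poly (k + m) (x_perm k m) (w_perm k m) = (\<Sum>i<min k m. monom 1 i)"
    by (simp add: KL_poly_eqI[OF is_KL_family_w_perm[OF assms]] x_perm_image)
  also have "{..<min k m} = {0..min (k - 1) (m - 1)}"
    using assms by auto
  finally show ?thesis .
qed

end
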